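(* Suppose $\hat h_\lambda$ is differentiable with $L$-Lipschitz gradient, and set $\Delta=\hat h_\lambda(\theta_0)-\inf_\theta\hat h_\lambda(\theta)$. Let $\theta_{t+1}=\theta_t-\alpha_tg_t$, $t=0,\dots,T-1$, with $g_t=2g_t^1-g_t^2$, be generated by the stochastic gradient procedure described in the context, in which each of the two stochastic gradients has bias at most $\delta$ and variance at most $\sigma^2$ ($\sigma>0$). Put $\hat\delta=3\delta$ and $\hat\sigma^2=5\sigma^2$. 1. If $T<\frac{2\Delta L}{\hat\sigma^2}$ and $\alpha_t=\frac1L$ for all $t$, then $$\frac1T\sum_{t=0}^{T-1}\mathbb E\big[\|\nabla\hat h_\lambda(\theta_t)\|^2\big]\le\frac{2L\Delta}{T}+\hat\delta^2+\hat\sigma^2.$$ 2. If $T\ge\frac{2\Delta L}{\hat\sigma^2}$ and $\alpha_t=\sqrt{\frac{2\Delta}{L\hat\sigma^2T}}$ for all $t$, then $$\frac1T\sum_{t=0}^{T-1}\mathbb E\big[\|\nabla\hat h_\lambda(\theta_t)\|^2\big]\le\hat\sigma\sqrt{\frac{8L\Delta}{T}}+\hat\delta^2.$$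
   Context: $c:\mathbb R^d\times\mathbb R^d\to\mathbb R$ is a cost function and $\lambda>0$. For probability distributions $\mu,\nu$ on $\mathbb R^d$, $d_{c,\lambda}(\mu,\nu)=\min_{\pi\in\Pi(\mu,\nu)}\int c\,d\pi+\lambda I(\pi)$, where $\Pi(\mu,\nu)$ is the set of couplings and $I$ is the KL regularizer $I(\pi)=\int\log\frac{d\pi}{d(\mu\times\nu)}d\pi$ or the norm-2 regularizer $I(\pi)=\frac12\int(\frac{d\pi}{d(\mu\times\nu)})^2d(\mu\times\nu)$; $\bar d_{c,\lambda}(\mu,\nu)=d_{c,\lambda}(\mu,\nu)-\lambda I(\pi^* )$ with $\pi^*$ the minimizer. $\mathbf q$ is a base distribution on $\mathcal X$, $\mathbf p$ a distribution on $\mathbb R^d$, $G_\theta:\mathcal X\to\mathbb R^d$ a parametrized family of one-to-one maps with $\theta$ in a Euclidean space, and $G_\theta(\mathbf q)$ is the pushforward. The generative Sinkhorn loss is $$\hat h_\lambda(\theta)=2\bar d_{c,\lambda}(G_\theta(\mathbf q),\mathbf p)-\bar d_{c,\lambda}(G_\theta(\mathbf q),G_\theta(\mathbf q))-\bar d_{c,\lambda}(\mathbf p,\mathbf p).$$ $\|\cdot\|$ is the Euclidean norm. Procedure: at iteration $t$, an oracle approximately solves the dual problems of $d_{c,\lambda}(G_{\theta_t}(\mathbf q),\mathbf p)$ and $d_{c,\lambda}(G_{\theta_t}(\mathbf q),G_{\theta_t}(\mathbf q))$, giving corresponding approximate transport plans $\pi_t^1,\pi_t^2$. Using fresh samples (independent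 of everything before, and independent of each other for the two terms), one forms stochastic gradients $g_t^1$ and $g_t^2$ of the two terms $\bar d_{c,\lambda}(G_\theta(\mathbf q),\mathbf p)$ and $\bar d_{c,\lambda}(G_\theta(\mathbf q),G_\theta(\mathbf q))$ at $\theta_t$, and sets $g_t=2g_t^1-g_t^2$, $\theta_{t+1}=\theta_t-\alpha_tg_t$. Thus, conditionally on the history $\xi_t$ (all of $\theta_s,\pi_s^1,\pi_s^2$, $s\le t$), $g_t^1$ and $g_t^2$ are independent. "Bias at most $\delta$ and variance at most $\sigma^2$" means that for all $t$: $\|\mathbb E[g_t^1\mid\xi_t]-\nabla_\theta\bar d_{c,\lambda}(G_\theta(\mathbf q),\mathbf p)|_{\theta=\theta_t}\|\le\delta$, $\|\mathbb E[g_t^2\mid\xi_t]-\nabla_\theta\bar d_{c,\lambda}(G_\theta(\mathbf q),G_\theta(\mathbf q))|_{\theta=\theta_t}\|\le\delta$, and $\mathbb E[\|g_t^k-\mathbb E[g_t^k\mid\xi_t]\|^2\mid\xi_t]\le\sigma^2$ for $k=1,2$. *)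

theory Defs
  imports "HOL-Probability.Probability"
begin

section \<open>Regularized optimal transport\<close>

definition couplings :: "'a measure \<Rightarrow> 'b measure \<Rightarrow> ('a \<times> 'b) measure set" where
  "couplings \<mu> \<nu> =
     {\<pi>. sets \<pi> = sets (\<mu> \<Otimes>\<^sub>M \<nu>) \<and> distr \<pi> \<mu> fst = \<mu> \<and> distr \<pi> \<nu> snd = \<nu>}"

datatype regularizer = KL | Norm2

text \<open>Both regularizers are infinite on plans without a density. \<^const>\<open>KL_divergence\<close> is a Bochner
  integral and would be 0 for a non-integrable log-density; as the negative part of the log-density
  is always \<open>\<pi>\<close>-integrable, non-integrability means that the divergence is infinite.\<close>

fun reg_value :: "regularizer \<Rightarrow> 'a measure \<Rightarrow> 'b measure \<Rightarrow> ('a \<times> 'b) measure \<Rightarrow> ereal" where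
  "reg_value KL \<mu> \<nu> \<pi> =
     (if absolutely_continuous (\<mu> \<Otimes>\<^sub>M \<nu>) \<pi> \<and>
         integrable \<pi> (entropy_density (exp 1) (\<mu> \<Otimes>\<^sub>M \<nu>) \<pi>)
      then ereal (KL_divergence (exp 1) (\<mu> \<Otimes>\<^sub>M \<nu>) \<pi>) else \<infinity>)"
| "reg_value Norm2 \<mu> \<nu> \<pi> =
     (if absolutely_continuous (\<mu> \<Otimes>\<^sub>M \<nu>) \<pi>
      then ereal (1 / 2) *
        enn2ereal (\<integral>\<^sup>+ z. (RN_deriv (\<mu> \<Otimes>\<^sub>M \<nu>) \<pi> z)\<^sup>2 \<partial>(\<mu> \<Otimes>\<^sub>M \<nu>))
      else \<infinity>)"

text \<open>The extended integral of a function of arbitrary sign. On \<^typ>\<open>ereal\<close>, \<open>\<infinity> - \<infinity> = \<infinity>\<close>, so a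
  plan for which the integral is undefined is never preferred in the minimization below.\<close>

definition ext_integral :: "'a measure \<Rightarrow> ('a \<Rightarrow> real) \<Rightarrow> ereal" where
  "ext_integral M f =
     enn2ereal (\<integral>\<^sup>+ z. ennreal (f z) \<partial>M) - enn2ereal (\<integral>\<^sup>+ z. ennreal (- f z) \<partial>M)"

definition ot_objective ::
  "regularizer \<Rightarrow> ('a \<times> 'b \<Rightarrow> real) \<Rightarrow> real \<Rightarrow> 'a measure \<Rightarrow> 'b measure \<Rightarrow> ('a \<times> 'b) measure \<Rightarrow> ereal"
where
  "ot_objective R c lam \<mu> \<nu> \<pi> = ext_integral \<pi> c + ereal lam * reg_value R \<mu> \<nu> \<pi>"

definition ot_cost ::
  "regularizer \<Rightarrow> ('a \<times> 'b \<Rightarrow> real) \<Rightarrow> real \<Rightarrow> 'a measure \<Rightarrow> 'b measure \<Rightarrow> ereal"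
where
  "ot_cost R c lam \<mu> \<nu> = (INF \<pi>\<in>couplings \<mu> \<nu>. ot_objective R c lam \<mu> \<nu> \<pi>)"

definition ot_plan ::
  "regularizer \<Rightarrow> ('a \<times> 'b \<Rightarrow> real) \<Rightarrow> real \<Rightarrow> 'a measure \<Rightarrow> 'b measure \<Rightarrow> ('a \<times> 'b) measure"
where
  "ot_plan R c lam \<mu> \<nu> = arg_min_on (ot_objective R c lam \<mu> \<nu>) (couplings \<mu> \<nu>)"

definition sharp_ot ::
  "regularizer \<Rightarrow> ('a \<times> 'b \<Rightarrow> real) \<Rightarrow> real \<Rightarrow> 'a measure \<Rightarrow> 'b measure \<Rightarrow> real"
where
  "sharp_ot R c lam \<mu> \<nu> =
     real_of_ereal (ot_cost R c lam \<mu> \<nu> - ereal lam * reg_value R \<mu> \<nu> (ot_plan R c lam \<mu> \<nu>))"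

definition sinkhorn_loss ::
  "regularizer \<Rightarrow> ('a::topological_space \<times> 'a \<Rightarrow> real) \<Rightarrow> real \<Rightarrow> 'x measure \<Rightarrow> 'a measure \<Rightarrow>
   ('p \<Rightarrow> 'x \<Rightarrow> 'a) \<Rightarrow> 'p \<Rightarrow> real"
where
  "sinkhorn_loss R c lam q p G \<theta> =
     2 * sharp_ot R c lam (distr q borel (G \<theta>)) p
     - sharp_ot R c lam (distr q borel (G \<theta>)) (distr q borel (G \<theta>))
     - sharp_ot R c lam p p"


section \<open>Gradients\<close>

definition grad :: "('a::real_inner \<Rightarrow> real) \<Rightarrow> 'a \<Rightarrow> 'a" where
  "grad f x = (THE D. GDERIV f x :> D)"


section \<open>Stochastic gradients and the history of the procedure\<close>

definition vec_cond_exp ::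
  "'w measure \<Rightarrow> 'w measure \<Rightarrow> ('w \<Rightarrow> 'e::euclidean_space) \<Rightarrow> 'w \<Rightarrow> 'e"
where
  "vec_cond_exp M F g \<omega> = (\<Sum>b\<in>Basis. real_cond_exp M F (\<lambda>w. g w \<bullet> b) \<omega> *\<^sub>R b)"

definition cond_indep ::
  "'w measure \<Rightarrow> 'w measure \<Rightarrow> ('w \<Rightarrow> 'e::topological_space) \<Rightarrow> ('w \<Rightarrow> 'f::topological_space) \<Rightarrow> bool"
where
  "cond_indep M F X Y \<longleftrightarrow>
     (\<forall>A\<in>sets borel. \<forall>B\<in>sets borel. AE \<omega> in M.
        real_cond_exp M F (\<lambda>w. indicator A (X w) * indicator B (Y w)) \<omega> =
        real_cond_exp M F (\<lambda>w. indicator A (X w)) \<omega> *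
        real_cond_exp M F (\<lambda>w. indicator B (Y w)) \<omega>)"

text \<open>The usual \<open>\<sigma>\<close>-algebra on measures, generated by the evaluations \<open>\<pi> \<mapsto> \<pi>(A)\<close>. In contrast to
  \<^const>\<open>subprob_algebra\<close> there is no restriction on the total mass: plans obtained from approximate
  dual solutions need not be exactly normalized.\<close>

definition measure_algebra :: "'a measure \<Rightarrow> 'a measure measure" where
  "measure_algebra K =
     (SUP A\<in>sets K. vimage_algebra {\<pi>. sets \<pi> = sets K} (\<lambda>\<pi>. emeasure \<pi> A) borel)"

text \<open>The \<open>\<sigma>\<close>-algebra generated by all \<open>\<theta> s\<close>, \<open>\<pi>1 s\<close>, \<open>\<pi>2 s\<close> with \<open>s \<le> t\<close>.\<close>

definition history ::
  "'w measure \<Rightarrow> (nat \<Rightarrow> 'w \<Rightarrow> 'p::topological_space) \<Rightarrow>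
   (nat \<Rightarrow> 'w \<Rightarrow> 'z::topological_space measure) \<Rightarrow> (nat \<Rightarrow> 'w \<Rightarrow> 'z measure) \<Rightarrow> nat \<Rightarrow> 'w measure"
where
  "history M \<theta> \<pi>1 \<pi>2 t =
     vimage_algebra (space M) (\<lambda>\<omega>. \<lambda>s\<in>{..t}. (\<theta> s \<omega>, \<pi>1 s \<omega>, \<pi>2 s \<omega>))
       (\<Pi>\<^sub>M s\<in>{..t}. borel \<Otimes>\<^sub>M measure_algebra borel \<Otimes>\<^sub>M measure_algebra borel)"

text \<open>The bias of \<open>g\<close> as an estimator of the gradient of \<open>f\<close> at the random point \<open>X\<close>, conditionally
  on \<open>F\<close>; the gradient is required to exist at that point.\<close>

definition bias_at_most ::
  "'w measure \<Rightarrow> 'w measure \<Rightarrow> ('e::euclidean_space \<Rightarrow> real) \<Rightarrow> ('w \<Rightarrow> 'e) \<Rightarrow> ('w \<Rightarrow> 'e) \<Rightarrow> real \<Rightarrow> bool"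
where
  "bias_at_most M F f X g \<delta> \<longleftrightarrow>
     (AE \<omega> in M. f differentiable (at (X \<omega>)) \<and>
        norm (vec_cond_exp M F g \<omega> - grad f (X \<omega>)) \<le> \<delta>)"

text \<open>\<^const>\<open>nn_cond_exp\<close> keeps infinite values, which \<^const>\<open>real_cond_exp\<close> would map to 0.\<close>

definition variance_at_most ::
  "'w measure \<Rightarrow> 'w measure \<Rightarrow> ('w \<Rightarrow> 'e::euclidean_space) \<Rightarrow> real \<Rightarrow> bool"
where
  "variance_at_most M F g v \<longleftrightarrow>
     (AE \<omega> in M.
        nn_cond_exp M F (\<lambda>w. ennreal ((norm (g w - vec_cond_exp M F g w))\<^sup>2)) \<omega> \<le> ennreal v)"

end

theory Submission
  imports Defs
begin

text \<open>Write the combined stochastic gradient as \<open>g = m + e\<close>, where \<open>m\<close> is its conditional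
  expectation given the history. Then \<open>\<parallel>m - \<nabla>h\<parallel> \<le> 3\<delta>\<close>, and the conditional
  independence of \<open>g\<^sub>1\<close> and \<open>g\<^sub>2\<close> makes their residuals orthogonal in \<open>L\<^sup>2\<close>, so that
  \<open>E \<parallel>e\<parallel>\<^sup>2 \<le> 4\<sigma>\<^sup>2 + \<sigma>\<^sup>2\<close>. With \<open>\<langle>\<nabla>h, m\<rangle> = (\<parallel>\<nabla>h\<parallel>\<^sup>2 + \<parallel>m\<parallel>\<^sup>2 - \<parallel>m - \<nabla>h\<parallel>\<^sup>2) / 2\<close>
  and \<open>\<alpha> L \<le> 1\<close>, the quadratic upper bound for a smooth function yields a descent inequality for
  \<open>E h(\<theta>\<^sub>t)\<close>, which telescopes.\<close>

text \<open>The stochastic gradients are only assumed integrable; second moments are given for their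
  residuals alone. Every square-integrability claim therefore has to be built up: for the residuals
  from the variance bound, for \<open>m\<close> from the gradient plus a bounded bias, and for the
  iterates by induction along the recursion, since the expectation of \<open>h\<close> is controlled
  through the second moment of its argument. Conditional independence is likewise given only for
  indicator events and must be extended to unbounded coordinates before it can remove the cross
  term. The factors 3 and 5 are \<open>2 + 1\<close> and \<open>2\<^sup>2 + 1\<^sup>2\<close>, from
  the coefficients of \<open>2 g1 - g2\<close>. Expanding the inner product of \<nabla>h and
  \<open>m\<close> by polarization lets the squared bias enter the averaged bound with coefficient
  one, and produces a term in \<open>m\<close> large enough to cancel the curvature term.\<close>

section \<open>Gradients and the quadratic upper bound\<close>

lemma GDERIV_unique:
  fixes f :: "'a::real_inner \<Rightarrow> real"
  assumes "GDERIV f x :> D" and "GDERIV f x :> E"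
  shows "D = E"
proof -
  have "(\<lambda>h. h \<bullet> D) = (\<lambda>h. h \<bullet> E)"
    using assms has_derivative_unique unfolding gderiv_def by blast
  then have "(D - E) \<bullet> (D - E) = 0"
    by (metis inner_diff_right right_minus_eq)
  then show ?thesis by simp
qed

lemma grad_eq:
  fixes f :: "'a::real_inner \<Rightarrow> real"
  assumes "GDERIV f x :> D"
  shows "grad f x = D"
  unfolding grad_def using assms GDERIV_unique by blast

text \<open>\<open>grad\<close> is a definite description, so a representing vector has to be
  exhibited; in a Euclidean space it is the one whose coordinates are the values of the derivative
  on \<open>Basis\<close>.\<close>

lemma GDERIV_grad:
  fixes f :: "'a::euclidean_space \<Rightarrow> real"
  assumes "f differentiable (at x)"
  shows "GDERIV f x :> grad f x"
proof -
  obtain f' where f': "(f has_derivative f') (at x)"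
    using assms unfolding differentiable_def by blast
  then have lin: "linear f'" by (rule has_derivative_linear)
  have "f' = (\<lambda>h. h \<bullet> (\<Sum>b\<in>Basis. f' b *\<^sub>R b))"
  proof
    fix h
    have "f' h = f' (\<Sum>b\<in>Basis. (h \<bullet> b) *\<^sub>R b)" by (simp add: euclidean_representation)
    also have "\<dots> = (\<Sum>b\<in>Basis. (h \<bullet> b) * f' b)"
      using lin by (simp add: linear_sum linear_scale)
    finally show "f' h = h \<bullet> (\<Sum>b\<in>Basis. f' b *\<^sub>R b)"
      by (simp add: inner_sum_right mult.commute)
  qed
  then have "GDERIV f x :> (\<Sum>b\<in>Basis. f' b *\<^sub>R b)"
    using f' unfolding gderiv_def by simp
  then show ?thesis using grad_eq by metis
qed

text \<open>Along the segment from \<open>x\<close> to \<open>x + d\<close>, the auxiliary \<phi>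
  subtracts from \<open>h\<close> the linear and quadratic terms of the claimed bound. The Lipschitz
  condition makes its derivative nonpositive on [0, 1], so comparing the endpoints suffices and the
  gradient is never integrated.\<close>

lemma descent:
  fixes h :: "'a::euclidean_space \<Rightarrow> real"
  assumes diff: "\<And>x. h differentiable (at x)" and lip: "L-lipschitz_on UNIV (grad h)"
  shows "h (x + d) \<le> h x + grad h x \<bullet> d + L / 2 * (norm d)\<^sup>2"
proof -
  define \<phi> where "\<phi> t = h (x + t *\<^sub>R d) - t * (grad h x \<bullet> d) - L / 2 * t\<^sup>2 * (norm d)\<^sup>2" for t
  have "\<phi> 1 \<le> \<phi> 0"
  proof (rule DERIV_nonpos_imp_nonincreasing[where f = \<phi> and a = 0 and b = 1])
    fix t :: real assume t: "0 \<le> t" "t \<le> 1"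
    let ?y = "x + t *\<^sub>R d"
    have "(h has_derivative (\<lambda>v. v \<bullet> grad h ?y)) (at ?y)"
      using GDERIV_grad[OF diff] unfolding gderiv_def .
    then have "((\<lambda>t. h (x + t *\<^sub>R d)) has_derivative (\<lambda>s. (s *\<^sub>R d) \<bullet> grad h ?y)) (at t)"
      by (intro has_derivative_compose[of "\<lambda>t. x + t *\<^sub>R d" "\<lambda>s. s *\<^sub>R d" t UNIV h])
        (auto intro!: derivative_eq_intros)
    then have "((\<lambda>t. h (x + t *\<^sub>R d)) has_field_derivative (d \<bullet> grad h ?y)) (at t)"
      by (simp add: has_field_derivative_def mult.commute[of _ "d \<bullet> _"])
    then have "(\<phi> has_field_derivative
        d \<bullet> grad h ?y - grad h x \<bullet> d - L * t * (norm d)\<^sup>2) (at t)"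
      unfolding \<phi>_def by (auto intro!: derivative_eq_intros)
    moreover have "d \<bullet> grad h ?y - grad h x \<bullet> d \<le> L * t * (norm d)\<^sup>2"
    proof -
      have "d \<bullet> grad h ?y - grad h x \<bullet> d = d \<bullet> (grad h ?y - grad h x)"
        by (simp add: inner_diff_right inner_commute)
      also have "\<dots> \<le> norm d * norm (grad h ?y - grad h x)" by (rule norm_cauchy_schwarz)
      also have "\<dots> \<le> norm d * (L * norm (?y - x))"
        using lipschitz_onD[OF lip, of ?y x] by (intro mult_left_mono) (auto simp: dist_norm)
      finally show ?thesis using t by (simp add: power2_eq_square mult_ac)
    qed
    ultimately show "\<exists>y. (\<phi> has_real_derivative y) (at t) \<and> y \<le> 0" by force
  qed simp
  then show ?thesis by (simp add: \<phi>_def)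
qed

text \<open>The step \<open>(- 1 / L) *\<^sub>R grad h x\<close> minimizes the quadratic upper bound
  at \<open>x\<close>; the decrease it guarantees,
  \<open>(norm (grad h x))\<^sup>2 / (2 * L)\<close>, cannot carry \<open>h\<close> below its
  infimum. A point attaining the infimum thus has zero gradient, which settles the degenerate case
  of step size 0.\<close>

lemma norm_grad_le:
  fixes h :: "'a::euclidean_space \<Rightarrow> real"
  assumes "\<And>x. h differentiable (at x)" and "L-lipschitz_on UNIV (grad h)" and L: "L > 0"
    and bdd: "bdd_below (range h)"
  shows "(norm (grad h x))\<^sup>2 \<le> 2 * L * (h x - (INF y. h y))"
proof -
  have "(INF y. h y) \<le> h (x + (- 1 / L) *\<^sub>R grad h x)"
    using bdd by (intro cINF_lower) auto
  also have "\<dots> \<le> h x + grad h x \<bullet> ((- 1 / L) *\<^sub>R grad h x)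
      + L / 2 * (norm ((- 1 / L) *\<^sub>R grad h x))\<^sup>2"
    by (rule descent[OF assms(1,2)])
  also have "\<dots> = h x - (norm (grad h x))\<^sup>2 / (2 * L)"
    using L by (simp add: power_mult_distrib power_divide dot_square_norm)
      (simp add: power2_eq_square field_simps)
  finally show ?thesis using L by (simp add: field_simps)
qed

section \<open>Measurability with respect to the history\<close>

text \<open>The second claim is what makes the true gradient at the current iterate an admissible
  test vector against the conditionally centered noise.\<close>

lemma subalgebra_history:
  assumes "\<And>s. s \<le> t \<Longrightarrow> \<theta> s \<in> borel_measurable M"
    and "\<And>s. s \<le> t \<Longrightarrow> \<pi>1 s \<in> M \<rightarrow>\<^sub>M measure_algebra borel"
    and "\<And>s. s \<le> t \<Longrightarrow> \<pi>2 s \<in> M \<rightarrow>\<^sub>M measure_algebra borel"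
  shows "subalgebra M (history M \<theta> \<pi>1 \<pi>2 t)"
    and "\<theta> t \<in> borel_measurable (history M \<theta> \<pi>1 \<pi>2 t)"
proof -
  let ?N = "borel \<Otimes>\<^sub>M measure_algebra borel \<Otimes>\<^sub>M measure_algebra borel"
  let ?f = "\<lambda>\<omega>. \<lambda>s\<in>{..t}. (\<theta> s \<omega>, \<pi>1 s \<omega>, \<pi>2 s \<omega>)"
  have f: "?f \<in> M \<rightarrow>\<^sub>M (\<Pi>\<^sub>M s\<in>{..t}. ?N)"
    using assms by (intro measurable_restrict measurable_Pair) auto
  show "subalgebra M (history M \<theta> \<pi>1 \<pi>2 t)"
    unfolding subalgebra_def history_def using sets_image_in_sets[OF refl f] by simp
  have F: "?f \<in> history M \<theta> \<pi>1 \<pi>2 t \<rightarrow>\<^sub>M (\<Pi>\<^sub>M s\<in>{..t}. ?N)"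
    unfolding history_def by (intro measurable_vimage_algebra1 measurable_space[OF f] Pi_I)
  have "(\<lambda>\<omega>. ?f \<omega> t) \<in> history M \<theta> \<pi>1 \<pi>2 t \<rightarrow>\<^sub>M ?N"
    using measurable_compose[OF F measurable_component_singleton[of t "{..t}"]] by simp
  from measurable_compose[OF this measurable_fst]
  show "\<theta> t \<in> borel_measurable (history M \<theta> \<pi>1 \<pi>2 t)" by simp
qed

section \<open>Conditional independence beyond indicators\<close>

text \<open>Each side is an integral of \<open>f\<close> against the image under \<open>X\<close> of
  the measure with density \<open>a\<close> or \<open>b\<close>. Agreement on indicators says that
  the two image measures coincide, so no approximation by simple functions has to be carried out,
  and infinite values are allowed.\<close>

lemma nn_integral_eq_of_indicators:
  assumes [measurable]: "X \<in> M \<rightarrow>\<^sub>M N" "a \<in> borel_measurable M" "b \<in> borel_measurable M"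
      "f \<in> borel_measurable N"
    and eq: "\<And>A. A \<in> sets N \<Longrightarrow>
      (\<integral>\<^sup>+\<omega>. a \<omega> * indicator A (X \<omega>) \<partial>M) = (\<integral>\<^sup>+\<omega>. b \<omega> * indicator A (X \<omega>) \<partial>M)"
  shows "(\<integral>\<^sup>+\<omega>. a \<omega> * f (X \<omega>) \<partial>M) = (\<integral>\<^sup>+\<omega>. b \<omega> * f (X \<omega>) \<partial>M)"
proof -
  have *: "(\<integral>\<^sup>+x. g x \<partial>distr (density M u) N X) = (\<integral>\<^sup>+\<omega>. u \<omega> * g (X \<omega>) \<partial>M)"
    if [measurable]: "u \<in> borel_measurable M" "g \<in> borel_measurable N" for g u
    by (simp add: nn_integral_distr nn_integral_density)
  have "distr (density M a) N X = distr (density M b) N X"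
  proof (rule measure_eqI)
    fix A assume "A \<in> sets (distr (density M a) N X)"
    then have [measurable]: "A \<in> sets N" by simp
    show "emeasure (distr (density M a) N X) A = emeasure (distr (density M b) N X) A"
      using *[of a "indicator A"] *[of b "indicator A"] eq[of A] by simp
  qed simp
  then show ?thesis using *[of a f] *[of b f] by simp
qed

text \<open>\<open>real_cond_exp\<close> is the difference of the \<open>enn2real\<close> values for
  the positive and the negative part. The negative part vanishes here and the positive one is almost
  everywhere finite by integrability, so \<open>enn2real\<close> loses nothing.\<close>

lemma (in sigma_finite_subalgebra) nn_cond_exp_eq_real_cond_exp:
  assumes f: "integrable M f" and nn: "\<And>\<omega>. f \<omega> \<ge> 0"
  shows "AE \<omega> in M. nn_cond_exp M F (\<lambda>\<omega>. ennreal (f \<omega>)) \<omega> = ennreal (real_cond_exp M F f \<omega>)"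
proof -
  have [measurable]: "f \<in> borel_measurable M" using f by simp
  have "(\<integral>\<^sup>+\<omega>. nn_cond_exp M F (\<lambda>\<omega>. ennreal (f \<omega>)) \<omega> \<partial>M) = (\<integral>\<^sup>+\<omega>. ennreal (f \<omega>) \<partial>M)"
    using nn_cond_exp_intg[of "\<lambda>_. 1" "\<lambda>\<omega>. ennreal (f \<omega>)"] by simp
  then have "AE \<omega> in M. nn_cond_exp M F (\<lambda>\<omega>. ennreal (f \<omega>)) \<omega> \<noteq> \<infinity>"
    using f nn by (intro nn_integral_PInf_AE) (auto simp: integrable_iff_bounded)
  moreover have "AE \<omega> in M. (\<lambda>_. 0) \<omega> = nn_cond_exp M F (\<lambda>_. 0) \<omega>"
    by (rule nn_cond_exp_F_meas) simp
  ultimately show ?thesis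
  proof eventually_elim
    case (elim \<omega>)
    moreover have "(\<lambda>\<omega>. ennreal (- f \<omega>)) = (\<lambda>_. 0)" using nn by (simp add: ennreal_neg)
    ultimately show ?case by (simp add: real_cond_exp_def less_top)
  qed
qed

text \<open>\<open>cond_indep\<close> speaks of \<open>real_cond_exp\<close>; in extended
  nonnegative form the product rule can be carried over to arbitrary nonnegative functions with no
  integrability to track.\<close>

lemma (in finite_measure_subalgebra) cond_indep_nn_cond_exp:
  assumes ind: "cond_indep M F X Y"
    and [measurable]: "X \<in> borel_measurable M" "Y \<in> borel_measurable M" "A \<in> sets borel" "B \<in> sets borel"
  shows "AE \<omega> in M. nn_cond_exp M F (\<lambda>\<omega>. indicator A (X \<omega>) * indicator B (Y \<omega>)) \<omega> =
    nn_cond_exp M F (\<lambda>\<omega>. indicator A (X \<omega>)) \<omega> * nn_cond_exp M F (\<lambda>\<omega>. indicator B (Y \<omega>)) \<omega>"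
proof -
  let ?A = "\<lambda>\<omega>. indicator A (X \<omega>) :: real" and ?B = "\<lambda>\<omega>. indicator B (Y \<omega>) :: real"
  have i: "integrable M ?A" "integrable M ?B" "integrable M (\<lambda>\<omega>. ?A \<omega> * ?B \<omega>)"
    by (auto intro!: integrable_const_bound[where B = 1] simp: indicator_def)
  have "AE \<omega> in M. real_cond_exp M F ?A \<omega> \<ge> 0" by (intro real_cond_exp_pos) auto
  moreover have "AE \<omega> in M. nn_cond_exp M F (\<lambda>\<omega>. ennreal (?A \<omega>)) \<omega> = ennreal (real_cond_exp M F ?A \<omega>)"
    "AE \<omega> in M. nn_cond_exp M F (\<lambda>\<omega>. ennreal (?B \<omega>)) \<omega> = ennreal (real_cond_exp M F ?B \<omega>)"
    "AE \<omega> in M. nn_cond_exp M F (\<lambda>\<omega>. ennreal (?A \<omega> * ?B \<omega>)) \<omega> =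
      ennreal (real_cond_exp M F (\<lambda>\<omega>. ?A \<omega> * ?B \<omega>) \<omega>)"
    by (intro nn_cond_exp_eq_real_cond_exp i; simp)+
  moreover have "AE \<omega> in M. real_cond_exp M F (\<lambda>\<omega>. ?A \<omega> * ?B \<omega>) \<omega> =
      real_cond_exp M F ?A \<omega> * real_cond_exp M F ?B \<omega>"
    using ind unfolding cond_indep_def by simp
  ultimately show ?thesis
  proof eventually_elim
    case (elim \<omega>)
    then show ?case by (simp add: ennreal_mult' ennreal_indicator[symmetric] flip: ennreal_mult')
  qed
qed

text \<open>Two passes of \<open>nn_integral_eq_of_indicators\<close>: the outer one puts a Borel
  set \<open>B\<close> in place of \<psi>, the inner one a Borel set \<open>A\<close> in place of
  \<phi>. On a pair of indicators the product rule applies, and weights measurable in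
  \<open>F\<close> let a factor be exchanged with its conditional expectation.\<close>

lemma (in finite_measure_subalgebra) cond_indep_nn_integral:
  assumes ind: "cond_indep M F X Y"
    and [measurable]: "X \<in> borel_measurable M" "Y \<in> borel_measurable M" "w \<in> borel_measurable F"
      "\<phi> \<in> borel_measurable borel" "\<psi> \<in> borel_measurable borel"
  shows "(\<integral>\<^sup>+\<omega>. w \<omega> * \<phi> (X \<omega>) * \<psi> (Y \<omega>) \<partial>M) =
    (\<integral>\<^sup>+\<omega>. w \<omega> * nn_cond_exp M F (\<lambda>\<omega>. \<phi> (X \<omega>)) \<omega> * \<psi> (Y \<omega>) \<partial>M)"
proof (rule nn_integral_eq_of_indicators[where X = Y and N = borel and f = \<psi>
      and a = "\<lambda>\<omega>. w \<omega> * \<phi> (X \<omega>)"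
      and b = "\<lambda>\<omega>. w \<omega> * nn_cond_exp M F (\<lambda>\<omega>. \<phi> (X \<omega>)) \<omega>"])
  have [measurable]: "w \<in> borel_measurable M" by (rule measurable_from_subalg[OF subalg]) simp
  then show "(\<lambda>\<omega>. w \<omega> * \<phi> (X \<omega>)) \<in> borel_measurable M"
    "(\<lambda>\<omega>. w \<omega> * nn_cond_exp M F (\<lambda>\<omega>. \<phi> (X \<omega>)) \<omega>) \<in> borel_measurable M" by measurable
  fix B :: "'c set" assume [measurable]: "B \<in> sets borel"
  let ?E = "nn_cond_exp M F"
  let ?B = "\<lambda>\<omega>. indicator B (Y \<omega>) :: ennreal"
  have "(\<integral>\<^sup>+\<omega>. (w \<omega> * ?B \<omega>) * \<phi> (X \<omega>) \<partial>M) = (\<integral>\<^sup>+\<omega>. (w \<omega> * ?E ?B \<omega>) * \<phi> (X \<omega>) \<partial>M)"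
  proof (rule nn_integral_eq_of_indicators[where X = X and N = borel and f = \<phi>
        and a = "\<lambda>\<omega>. w \<omega> * ?B \<omega>" and b = "\<lambda>\<omega>. w \<omega> * ?E ?B \<omega>"])
    fix A :: "'b set" assume [measurable]: "A \<in> sets borel"
    let ?A = "\<lambda>\<omega>. indicator A (X \<omega>) :: ennreal"
    have "(\<integral>\<^sup>+\<omega>. (w \<omega> * ?B \<omega>) * ?A \<omega> \<partial>M) = (\<integral>\<^sup>+\<omega>. w \<omega> * (?A \<omega> * ?B \<omega>) \<partial>M)"
      by (simp add: mult_ac)
    also have "\<dots> = (\<integral>\<^sup>+\<omega>. w \<omega> * ?E (\<lambda>\<omega>. ?A \<omega> * ?B \<omega>) \<omega> \<partial>M)"
      by (rule nn_cond_exp_intg[symmetric]) measurable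
    also have "\<dots> = (\<integral>\<^sup>+\<omega>. (w \<omega> * ?E ?B \<omega>) * ?E ?A \<omega> \<partial>M)"
    proof (rule nn_integral_cong_AE)
      have "AE \<omega> in M. ?E (\<lambda>\<omega>. ?A \<omega> * ?B \<omega>) \<omega> = ?E ?A \<omega> * ?E ?B \<omega>"
        by (rule cond_indep_nn_cond_exp[OF ind]) measurable
      then show "AE \<omega> in M. w \<omega> * ?E (\<lambda>\<omega>. ?A \<omega> * ?B \<omega>) \<omega> = (w \<omega> * ?E ?B \<omega>) * ?E ?A \<omega>"
        by eventually_elim (simp add: mult_ac)
    qed
    also have "\<dots> = (\<integral>\<^sup>+\<omega>. (w \<omega> * ?E ?B \<omega>) * ?A \<omega> \<partial>M)"
      by (rule nn_cond_exp_intg) measurable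
    finally show "(\<integral>\<^sup>+\<omega>. (w \<omega> * ?B \<omega>) * ?A \<omega> \<partial>M) = (\<integral>\<^sup>+\<omega>. (w \<omega> * ?E ?B \<omega>) * ?A \<omega> \<partial>M)" .
  qed measurable
  \<comment> \<open>Now the conditional expectation moves from \<open>B\<close> to \<phi>: the
    weight \<open>w \<omega> * ?E ?B \<omega>\<close> is measurable in \<open>F\<close>, so
    \<open>\<phi> (X \<omega>)\<close> may be replaced by its conditional expectation, after which
    \<open>?E ?B\<close> is turned back into the indicator in the same way.\<close>
  also have "\<dots> = (\<integral>\<^sup>+\<omega>. (w \<omega> * ?E ?B \<omega>) * ?E (\<lambda>\<omega>. \<phi> (X \<omega>)) \<omega> \<partial>M)"
    by (rule nn_cond_exp_intg[symmetric]) measurable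
  also have "\<dots> = (\<integral>\<^sup>+\<omega>. (w \<omega> * ?E (\<lambda>\<omega>. \<phi> (X \<omega>)) \<omega>) * ?E ?B \<omega> \<partial>M)"
    by (intro nn_integral_cong) (simp only: mult_ac)
  also have "\<dots> = (\<integral>\<^sup>+\<omega>. (w \<omega> * ?E (\<lambda>\<omega>. \<phi> (X \<omega>)) \<omega>) * ?B \<omega> \<partial>M)"
    by (rule nn_cond_exp_intg) measurable
  finally show "(\<integral>\<^sup>+\<omega>. w \<omega> * \<phi> (X \<omega>) * ?B \<omega> \<partial>M) =
      (\<integral>\<^sup>+\<omega>. w \<omega> * ?E (\<lambda>\<omega>. \<phi> (X \<omega>)) \<omega> * ?B \<omega> \<partial>M)"
    by (simp add: mult_ac)
qed (use assms in auto)

lemma integral_eq_of_nn_integral_eq: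
  fixes f g :: "'a \<Rightarrow> real"
  assumes "integrable M f" and [measurable]: "g \<in> borel_measurable M"
    and f: "AE x in M. 0 \<le> f x" and g: "AE x in M. 0 \<le> g x"
    and eq: "(\<integral>\<^sup>+x. ennreal (f x) \<partial>M) = (\<integral>\<^sup>+x. ennreal (g x) \<partial>M)"
  shows "integrable M g" and "(\<integral>x. f x \<partial>M) = (\<integral>x. g x \<partial>M)"
proof -
  have *: "(\<integral>\<^sup>+x. ennreal (g x) \<partial>M) = ennreal (\<integral>x. f x \<partial>M)"
    using nn_integral_eq_integral[OF assms(1) f] eq by simp
  then show "integrable M g" by (intro integrableI_nonneg g) auto
  then have "ennreal (\<integral>x. g x \<partial>M) = ennreal (\<integral>x. f x \<partial>M)"
    using nn_integral_eq_integral[OF _ g] * by simp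
  then show "(\<integral>x. f x \<partial>M) = (\<integral>x. g x \<partial>M)"
    using integral_nonneg_AE[OF f] integral_nonneg_AE[OF g] by simp
qed

context finite_measure_subalgebra
begin

text \<open>Integrability of \<open>u (X \<omega>)\<close> makes the real and the extended
  conditional expectations agree. Integrability of the product with the conditional expectation is
  then inherited from the original product through equality of the nonnegative integrals.\<close>

lemma cond_indep_integral_nonneg:
  assumes ind: "cond_indep M F X Y"
    and [measurable]: "X \<in> borel_measurable M" "Y \<in> borel_measurable M" "w \<in> borel_measurable F"
      "u \<in> borel_measurable borel" "v \<in> borel_measurable borel"
    and nn: "\<And>\<omega>. w \<omega> \<ge> 0" "\<And>x. u x \<ge> 0" "\<And>y. v y \<ge> (0::real)"
    and iu: "integrable M (\<lambda>\<omega>. u (X \<omega>))"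
    and i: "integrable M (\<lambda>\<omega>. w \<omega> * u (X \<omega>) * v (Y \<omega>))"
  shows "integrable M (\<lambda>\<omega>. w \<omega> * real_cond_exp M F (\<lambda>\<omega>. u (X \<omega>)) \<omega> * v (Y \<omega>))"
    and "(\<integral>\<omega>. w \<omega> * u (X \<omega>) * v (Y \<omega>) \<partial>M) =
      (\<integral>\<omega>. w \<omega> * real_cond_exp M F (\<lambda>\<omega>. u (X \<omega>)) \<omega> * v (Y \<omega>) \<partial>M)"
proof -
  let ?E = "real_cond_exp M F (\<lambda>\<omega>. u (X \<omega>))"
  have [measurable]: "w \<in> borel_measurable M" by (rule measurable_from_subalg[OF subalg]) simp
  have pos: "AE \<omega> in M. ?E \<omega> \<ge> 0" using nn by (intro real_cond_exp_pos) auto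
  have "(\<integral>\<^sup>+\<omega>. ennreal (w \<omega> * u (X \<omega>) * v (Y \<omega>)) \<partial>M) =
      (\<integral>\<^sup>+\<omega>. ennreal (w \<omega>) * ennreal (u (X \<omega>)) * ennreal (v (Y \<omega>)) \<partial>M)"
    using nn by (simp add: ennreal_mult)
  also have "\<dots> = (\<integral>\<^sup>+\<omega>. ennreal (w \<omega>) * nn_cond_exp M F (\<lambda>\<omega>. ennreal (u (X \<omega>))) \<omega> *
      ennreal (v (Y \<omega>)) \<partial>M)"
    by (rule cond_indep_nn_integral[OF ind]) measurable
  also have "\<dots> = (\<integral>\<^sup>+\<omega>. ennreal (w \<omega> * ?E \<omega> * v (Y \<omega>)) \<partial>M)"
  proof (rule nn_integral_cong_AE)
    have "AE \<omega> in M. nn_cond_exp M F (\<lambda>\<omega>. ennreal (u (X \<omega>))) \<omega> = ennreal (?E \<omega>)"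
      by (intro nn_cond_exp_eq_real_cond_exp iu nn)
    with pos show "AE \<omega> in M. ennreal (w \<omega>) * nn_cond_exp M F (\<lambda>\<omega>. ennreal (u (X \<omega>))) \<omega> *
        ennreal (v (Y \<omega>)) = ennreal (w \<omega> * ?E \<omega> * v (Y \<omega>))"
      by eventually_elim (simp add: nn ennreal_mult)
  qed
  finally have eq: "(\<integral>\<^sup>+\<omega>. ennreal (w \<omega> * u (X \<omega>) * v (Y \<omega>)) \<partial>M) =
      (\<integral>\<^sup>+\<omega>. ennreal (w \<omega> * ?E \<omega> * v (Y \<omega>)) \<partial>M)" .
  have m: "(\<lambda>\<omega>. w \<omega> * ?E \<omega> * v (Y \<omega>)) \<in> borel_measurable M" by measurable
  have n1: "AE \<omega> in M. 0 \<le> w \<omega> * u (X \<omega>) * v (Y \<omega>)" using nn by simp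
  have n2: "AE \<omega> in M. 0 \<le> w \<omega> * ?E \<omega> * v (Y \<omega>)"
    using pos by eventually_elim (simp add: nn)
  show "integrable M (\<lambda>\<omega>. w \<omega> * ?E \<omega> * v (Y \<omega>))"
    and "(\<integral>\<omega>. w \<omega> * u (X \<omega>) * v (Y \<omega>) \<partial>M) = (\<integral>\<omega>. w \<omega> * ?E \<omega> * v (Y \<omega>) \<partial>M)"
    by (fact integral_eq_of_nn_integral_eq[OF i m n1 n2 eq])+
qed

text \<open>Splitting \<open>u\<close> and \<open>v\<close> into positive and negative parts gives
  four nonnegative products; each is dominated by the absolute value of the original one, so the
  integrability hypothesis passes to all four.\<close>

lemma cond_indep_integral:
  assumes ind: "cond_indep M F X Y"
    and [measurable]: "X \<in> borel_measurable M" "Y \<in> borel_measurable M" "w \<in> borel_measurable F"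
      "u \<in> borel_measurable borel" "v \<in> borel_measurable borel"
    and nn: "\<And>\<omega>. w \<omega> \<ge> (0::real)"
    and iu: "integrable M (\<lambda>\<omega>. u (X \<omega>))"
    and i: "integrable M (\<lambda>\<omega>. w \<omega> * u (X \<omega>) * v (Y \<omega>))"
  shows "integrable M (\<lambda>\<omega>. w \<omega> * real_cond_exp M F (\<lambda>\<omega>. u (X \<omega>)) \<omega> * v (Y \<omega>))"
    and "(\<integral>\<omega>. w \<omega> * u (X \<omega>) * v (Y \<omega>) \<partial>M) =
      (\<integral>\<omega>. w \<omega> * real_cond_exp M F (\<lambda>\<omega>. u (X \<omega>)) \<omega> * v (Y \<omega>) \<partial>M)"
proof -
  have [measurable]: "w \<in> borel_measurable M" by (rule measurable_from_subalg[OF subalg]) simp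
  \<comment> \<open>The signs \<open>s = 1\<close> and \<open>s = -1\<close> give the positive and
    the negative part, so one statement over signs covers all four products.\<close>
  define pos where "pos s z = max 0 (s * z)" for s z :: real
  have pos_nonneg: "pos s z \<ge> 0" for s z by (simp add: pos_def)
  have [measurable]: "pos s \<in> borel_measurable borel" for s unfolding pos_def by measurable
  have pos_diff: "z = pos 1 z - pos (-1) z" for z by (simp add: pos_def)
  let ?E = "\<lambda>s. real_cond_exp M F (\<lambda>\<omega>. pos s (u (X \<omega>)))"
  have pos_le: "\<bar>pos s z\<bar> \<le> \<bar>z\<bar>" if "\<bar>s\<bar> = 1" for s z
  proof -
    have "\<bar>s * z\<bar> = \<bar>z\<bar>" using that by (simp add: abs_mult)
    then show ?thesis unfolding pos_def by linarith
  qed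
  have iu': "integrable M (\<lambda>\<omega>. pos s (u (X \<omega>)))" if "\<bar>s\<bar> = 1" for s
    by (rule Bochner_Integration.integrable_bound[OF iu]) (simp_all add: pos_le[OF that])
  have i': "integrable M (\<lambda>\<omega>. w \<omega> * pos s (u (X \<omega>)) * pos r (v (Y \<omega>)))"
    if "\<bar>s\<bar> = 1" "\<bar>r\<bar> = 1" for s r
    by (rule Bochner_Integration.integrable_bound[OF i])
      (auto simp: abs_mult intro!: mult_mono AE_I2 pos_le that)
  have *: "integrable M (\<lambda>\<omega>. w \<omega> * ?E s \<omega> * pos r (v (Y \<omega>)))"
      "(\<integral>\<omega>. w \<omega> * pos s (u (X \<omega>)) * pos r (v (Y \<omega>)) \<partial>M) =
        (\<integral>\<omega>. w \<omega> * ?E s \<omega> * pos r (v (Y \<omega>)) \<partial>M)" if "\<bar>s\<bar> = 1" "\<bar>r\<bar> = 1" for s r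
    using cond_indep_integral_nonneg[OF ind, of w "\<lambda>x. pos s (u x)" "\<lambda>y. pos r (v y)"]
      nn iu'[OF that(1)] i'[OF that] pos_nonneg by simp_all
  \<comment> \<open>Additivity of conditional expectation holds only almost everywhere, hence so
    does this decomposition.\<close>
  have AE: "AE \<omega> in M. w \<omega> * real_cond_exp M F (\<lambda>\<omega>. u (X \<omega>)) \<omega> * v (Y \<omega>) =
      w \<omega> * ?E 1 \<omega> * pos 1 (v (Y \<omega>)) - w \<omega> * ?E 1 \<omega> * pos (-1) (v (Y \<omega>)) -
      (w \<omega> * ?E (-1) \<omega> * pos 1 (v (Y \<omega>)) - w \<omega> * ?E (-1) \<omega> * pos (-1) (v (Y \<omega>)))"
  proof -
    have "AE \<omega> in M. real_cond_exp M F (\<lambda>\<omega>. pos 1 (u (X \<omega>)) - pos (-1) (u (X \<omega>))) \<omega> =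
        ?E 1 \<omega> - ?E (-1) \<omega>"
      by (intro real_cond_exp_diff iu') auto
    then show ?thesis
      unfolding pos_diff[symmetric]
    proof eventually_elim
      case (elim \<omega>)
      show ?case
        unfolding elim by (subst (1) pos_diff) (simp add: algebra_simps)
    qed
  qed
  have I: "integrable M (\<lambda>\<omega>. w \<omega> * ?E 1 \<omega> * pos 1 (v (Y \<omega>)) - w \<omega> * ?E 1 \<omega> * pos (-1) (v (Y \<omega>)) -
      (w \<omega> * ?E (-1) \<omega> * pos 1 (v (Y \<omega>)) - w \<omega> * ?E (-1) \<omega> * pos (-1) (v (Y \<omega>))))"
    by (intro Bochner_Integration.integrable_diff *) auto
  show "integrable M (\<lambda>\<omega>. w \<omega> * real_cond_exp M F (\<lambda>\<omega>. u (X \<omega>)) \<omega> * v (Y \<omega>))"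
    by (rule integrable_cong_AE_imp[OF I]) (use AE in auto)
  have "(\<integral>\<omega>. w \<omega> * u (X \<omega>) * v (Y \<omega>) \<partial>M) =
      (\<integral>\<omega>. w \<omega> * pos 1 (u (X \<omega>)) * pos 1 (v (Y \<omega>)) - w \<omega> * pos 1 (u (X \<omega>)) * pos (-1) (v (Y \<omega>)) -
      (w \<omega> * pos (-1) (u (X \<omega>)) * pos 1 (v (Y \<omega>)) - w \<omega> * pos (-1) (u (X \<omega>)) * pos (-1) (v (Y \<omega>))) \<partial>M)"
  proof (rule Bochner_Integration.integral_cong[OF refl])
    fix \<omega>
    have "w \<omega> * u (X \<omega>) * v (Y \<omega>) = w \<omega> * (pos 1 (u (X \<omega>)) - pos (-1) (u (X \<omega>))) *
        (pos 1 (v (Y \<omega>)) - pos (-1) (v (Y \<omega>)))"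
      by (simp flip: pos_diff)
    then show "w \<omega> * u (X \<omega>) * v (Y \<omega>) = w \<omega> * pos 1 (u (X \<omega>)) * pos 1 (v (Y \<omega>)) -
        w \<omega> * pos 1 (u (X \<omega>)) * pos (-1) (v (Y \<omega>)) -
        (w \<omega> * pos (-1) (u (X \<omega>)) * pos 1 (v (Y \<omega>)) - w \<omega> * pos (-1) (u (X \<omega>)) * pos (-1) (v (Y \<omega>)))"
      by (simp add: algebra_simps)
  qed
  also have "\<dots> = (\<integral>\<omega>. w \<omega> * ?E 1 \<omega> * pos 1 (v (Y \<omega>)) - w \<omega> * ?E 1 \<omega> * pos (-1) (v (Y \<omega>)) -
      (w \<omega> * ?E (-1) \<omega> * pos 1 (v (Y \<omega>)) - w \<omega> * ?E (-1) \<omega> * pos (-1) (v (Y \<omega>))) \<partial>M)"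
    by (simp add: * i')
  also have "\<dots> = (\<integral>\<omega>. w \<omega> * real_cond_exp M F (\<lambda>\<omega>. u (X \<omega>)) \<omega> * v (Y \<omega>) \<partial>M)"
    by (rule integral_cong_AE) (use AE in auto)
  finally show "(\<integral>\<omega>. w \<omega> * u (X \<omega>) * v (Y \<omega>) \<partial>M) =
      (\<integral>\<omega>. w \<omega> * real_cond_exp M F (\<lambda>\<omega>. u (X \<omega>)) \<omega> * v (Y \<omega>) \<partial>M)" .
qed

text \<open>Only the residuals are square integrable, not \<open>u(X)\<close> and \<open>v(Y)\<close> themselves, so the product is first
  truncated to the \<open>F\<close>-measurable event on which both conditional expectations are at most \<open>n\<close>.\<close>

lemma cond_indep_centered_orthogonal:
  fixes u :: "'b::topological_space \<Rightarrow> real" and v :: "'c::topological_space \<Rightarrow> real"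
    and X :: "'a \<Rightarrow> 'b" and Y :: "'a \<Rightarrow> 'c"
  defines "a \<equiv> real_cond_exp M F (\<lambda>\<omega>. u (X \<omega>))" and "b \<equiv> real_cond_exp M F (\<lambda>\<omega>. v (Y \<omega>))"
  assumes ind: "cond_indep M F X Y"
    and [measurable]: "X \<in> borel_measurable M" "Y \<in> borel_measurable M"
      "u \<in> borel_measurable borel" "v \<in> borel_measurable borel"
    and iu: "integrable M (\<lambda>\<omega>. u (X \<omega>))" and iv: "integrable M (\<lambda>\<omega>. v (Y \<omega>))"
    and su: "integrable M (\<lambda>\<omega>. (u (X \<omega>) - a \<omega>)\<^sup>2)"
    and sv: "integrable M (\<lambda>\<omega>. (v (Y \<omega>) - b \<omega>)\<^sup>2)"
  shows "(\<integral>\<omega>. (u (X \<omega>) - a \<omega>) * (v (Y \<omega>) - b \<omega>) \<partial>M) = 0"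
proof -
  have [measurable]: "a \<in> borel_measurable F" "b \<in> borel_measurable F"
    "a \<in> borel_measurable M" "b \<in> borel_measurable M" unfolding a_def b_def by measurable
  define w :: "nat \<Rightarrow> 'a \<Rightarrow> real" where
    "w n \<omega> = (if \<bar>a \<omega>\<bar> \<le> real n \<and> \<bar>b \<omega>\<bar> \<le> real n then 1 else 0)" for n \<omega>
  have [measurable]: "w n \<in> borel_measurable F" "w n \<in> borel_measurable M" for n
    unfolding w_def by measurable
  have zero: "(\<integral>\<omega>. w n \<omega> * ((u (X \<omega>) - a \<omega>) * (v (Y \<omega>) - b \<omega>)) \<partial>M) = 0" for n
  proof -
    let ?U = "\<lambda>\<omega>. u (X \<omega>)" and ?V = "\<lambda>\<omega>. v (Y \<omega>)"
    have "integrable M (\<lambda>\<omega>. w n \<omega> * ?U \<omega> * ?V \<omega>)"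
    proof (rule Bochner_Integration.integrable_bound)
      show "integrable M (\<lambda>\<omega>. (?U \<omega> - a \<omega>)\<^sup>2 + (?V \<omega> - b \<omega>)\<^sup>2 + 2 * (real n)\<^sup>2)"
        by (intro Bochner_Integration.integrable_add su sv) auto
      have "\<bar>x * y\<bar> \<le> (x - c)\<^sup>2 + (y - d)\<^sup>2 + 2 * (real n)\<^sup>2"
        if "\<bar>c\<bar> \<le> real n" "\<bar>d\<bar> \<le> real n" for x y c d :: real
      proof -
        have "2 * \<bar>x * y\<bar> \<le> x\<^sup>2 + y\<^sup>2"
          using sum_squares_bound[of "\<bar>x\<bar>" "\<bar>y\<bar>"] by (simp add: abs_mult)
        \<comment> \<open>The right-hand sides exceed the left-hand sides by the squares of
          \<open>x - 2 * c\<close> and \<open>y - 2 * d\<close>.\<close>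
        moreover have "x\<^sup>2 \<le> 2 * (x - c)\<^sup>2 + 2 * c\<^sup>2" "y\<^sup>2 \<le> 2 * (y - d)\<^sup>2 + 2 * d\<^sup>2"
          using zero_le_power2[of "x - 2 * c"] zero_le_power2[of "y - 2 * d"]
          by (simp_all add: power2_eq_square algebra_simps)
        moreover have "c\<^sup>2 \<le> (real n)\<^sup>2" "d\<^sup>2 \<le> (real n)\<^sup>2"
          using that by (simp_all add: abs_le_square_iff[symmetric])
        ultimately show ?thesis by linarith
      qed
      then show "AE \<omega> in M. norm (w n \<omega> * ?U \<omega> * ?V \<omega>) \<le>
          norm ((?U \<omega> - a \<omega>)\<^sup>2 + (?V \<omega> - b \<omega>)\<^sup>2 + 2 * (real n)\<^sup>2)"
        by (auto simp: w_def)
    qed measurable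
    note * = this
      cond_indep_integral[OF ind _ _ _ _ _ _ iu this, folded a_def]
    \<comment> \<open>Wherever \<open>w n\<close> is nonzero, \<open>b\<close> is at most
      \<open>n\<close> in absolute value.\<close>
    have **: "integrable M (\<lambda>\<omega>. (w n \<omega> * b \<omega>) * ?U \<omega>)"
      by (rule Bochner_Integration.integrable_bound[of _ "\<lambda>\<omega>. real n * ?U \<omega>"])
        (use iu in \<open>auto simp: w_def abs_mult intro!: mult_right_mono\<close>)
    note *** = ** real_cond_exp_intg[OF **, folded a_def]
    \<comment> \<open>Expanding the product gives two differences. The first integrates to zero by
      conditional independence, which replaces \<open>?U\<close> by \<open>a\<close>; the second by
      the defining property of \<open>a\<close>, tested with the weight
      \<open>w n \<omega> * b \<omega>\<close>.\<close>
    have "(\<integral>\<omega>. w n \<omega> * ((?U \<omega> - a \<omega>) * (?V \<omega> - b \<omega>)) \<partial>M) =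
        (\<integral>\<omega>. (w n \<omega> * ?U \<omega> * ?V \<omega> - w n \<omega> * a \<omega> * ?V \<omega>) -
          ((w n \<omega> * b \<omega>) * ?U \<omega> - (w n \<omega> * b \<omega>) * a \<omega>) \<partial>M)"
      by (intro Bochner_Integration.integral_cong) (auto simp: algebra_simps)
    also have "\<dots> = 0"
      using * *** by (simp add: w_def)
    finally show ?thesis .
  qed
  \<comment> \<open>\<open>a\<close> and \<open>b\<close> are real-valued, so every point eventually
    satisfies the cutoff; the squares of the residuals supply the dominating function.\<close>
  have "(\<lambda>n. \<integral>\<omega>. w n \<omega> * ((u (X \<omega>) - a \<omega>) * (v (Y \<omega>) - b \<omega>)) \<partial>M) \<longlonglongrightarrow>
      (\<integral>\<omega>. (u (X \<omega>) - a \<omega>) * (v (Y \<omega>) - b \<omega>) \<partial>M)"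
  proof (rule integral_dominated_convergence)
    show "integrable M (\<lambda>\<omega>. (u (X \<omega>) - a \<omega>)\<^sup>2 + (v (Y \<omega>) - b \<omega>)\<^sup>2)"
      using su sv by simp
    show "AE \<omega> in M. norm (w n \<omega> * ((u (X \<omega>) - a \<omega>) * (v (Y \<omega>) - b \<omega>))) \<le>
        (u (X \<omega>) - a \<omega>)\<^sup>2 + (v (Y \<omega>) - b \<omega>)\<^sup>2" for n
    proof (rule AE_I2)
      fix \<omega>
      have "2 * \<bar>(u (X \<omega>) - a \<omega>) * (v (Y \<omega>) - b \<omega>)\<bar> \<le> (u (X \<omega>) - a \<omega>)\<^sup>2 + (v (Y \<omega>) - b \<omega>)\<^sup>2"
        using sum_squares_bound[of "\<bar>u (X \<omega>) - a \<omega>\<bar>" "\<bar>v (Y \<omega>) - b \<omega>\<bar>"] by (simp add: abs_mult)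
      then have "\<bar>(u (X \<omega>) - a \<omega>) * (v (Y \<omega>) - b \<omega>)\<bar> \<le> (u (X \<omega>) - a \<omega>)\<^sup>2 + (v (Y \<omega>) - b \<omega>)\<^sup>2"
        by linarith
      then show "norm (w n \<omega> * ((u (X \<omega>) - a \<omega>) * (v (Y \<omega>) - b \<omega>))) \<le>
          (u (X \<omega>) - a \<omega>)\<^sup>2 + (v (Y \<omega>) - b \<omega>)\<^sup>2"
        by (simp add: w_def)
    qed
    show "AE \<omega> in M. (\<lambda>n. w n \<omega> * ((u (X \<omega>) - a \<omega>) * (v (Y \<omega>) - b \<omega>))) \<longlonglongrightarrow>
        (u (X \<omega>) - a \<omega>) * (v (Y \<omega>) - b \<omega>)"
    proof (rule AE_I2)
      fix \<omega>
      obtain N where N: "max \<bar>a \<omega>\<bar> \<bar>b \<omega>\<bar> \<le> real N" using real_arch_simple by blast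
      have "\<forall>\<^sub>F n in sequentially. w n \<omega> * ((u (X \<omega>) - a \<omega>) * (v (Y \<omega>) - b \<omega>)) =
          (u (X \<omega>) - a \<omega>) * (v (Y \<omega>) - b \<omega>)"
        using eventually_ge_at_top[of N]
      proof eventually_elim
        case (elim n)
        then have "real N \<le> real n" by simp
        then show ?case using N by (simp add: w_def)
      qed
      then show "(\<lambda>n. w n \<omega> * ((u (X \<omega>) - a \<omega>) * (v (Y \<omega>) - b \<omega>))) \<longlonglongrightarrow>
          (u (X \<omega>) - a \<omega>) * (v (Y \<omega>) - b \<omega>)"
        by (rule tendsto_eventually)
    qed
  qed measurable
  then show ?thesis using zero LIMSEQ_unique[OF _ tendsto_const] by simp
qed

end

section \<open>Square-integrable random vectors\<close>

definition square_integrable :: "'a measure \<Rightarrow> ('a \<Rightarrow> 'b::euclidean_space) \<Rightarrow> bool" where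
  "square_integrable M f \<longleftrightarrow>
     f \<in> borel_measurable M \<and> integrable M (\<lambda>\<omega>. (norm (f \<omega>))\<^sup>2)"

lemma square_integrable_bound:
  assumes g: "square_integrable M g" and f: "f \<in> borel_measurable M"
    and le: "AE \<omega> in M. norm (f \<omega>) \<le> norm (g \<omega>)"
  shows "square_integrable M f"
proof -
  have g2: "integrable M (\<lambda>\<omega>. (norm (g \<omega>))\<^sup>2)" using g by (simp add: square_integrable_def)
  have "AE \<omega> in M. norm ((norm (f \<omega>))\<^sup>2) \<le> norm ((norm (g \<omega>))\<^sup>2)"
    using le by eventually_elim (simp add: power_mono)
  then have "integrable M (\<lambda>\<omega>. (norm (f \<omega>))\<^sup>2)"
    using f by (intro Bochner_Integration.integrable_bound[OF g2]) auto
  then show ?thesis using f by (simp add: square_integrable_def)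
qed

lemma square_integrable_scaleR:
  "square_integrable M f \<Longrightarrow> square_integrable M (\<lambda>\<omega>. a *\<^sub>R f \<omega>)"
  unfolding square_integrable_def by (auto simp: power_mult_distrib)

lemma integrable_inner_square_integrable:
  assumes "square_integrable M f" and "square_integrable M g"
  shows "integrable M (\<lambda>\<omega>. f \<omega> \<bullet> g \<omega>)"
proof -
  have [measurable]: "f \<in> borel_measurable M" "g \<in> borel_measurable M"
    and i: "integrable M (\<lambda>\<omega>. (norm (f \<omega>))\<^sup>2 + (norm (g \<omega>))\<^sup>2)"
    using assms unfolding square_integrable_def by auto
  have "\<bar>x \<bullet> y\<bar> \<le> (norm x)\<^sup>2 + (norm y)\<^sup>2" for x y :: 'b
    using Cauchy_Schwarz_ineq2[of x y] sum_squares_bound[of "norm x" "norm y"]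
      mult_nonneg_nonneg[OF norm_ge_zero[of x] norm_ge_zero[of y]] by linarith
  then show ?thesis
    by (intro Bochner_Integration.integrable_bound[OF i]) auto
qed

lemma square_integrable_add:
  assumes f: "square_integrable M f" and g: "square_integrable M g"
  shows "square_integrable M (\<lambda>\<omega>. f \<omega> + g \<omega>)"
proof -
  have "integrable M (\<lambda>\<omega>. (norm (f \<omega>))\<^sup>2 + (norm (g \<omega>))\<^sup>2 + 2 * (f \<omega> \<bullet> g \<omega>))"
    using f g integrable_inner_square_integrable[OF f g] unfolding square_integrable_def by simp
  moreover have "(norm (f \<omega> + g \<omega>))\<^sup>2 = (norm (f \<omega>))\<^sup>2 + (norm (g \<omega>))\<^sup>2 + 2 * (f \<omega> \<bullet> g \<omega>)" for \<omega>
    by (simp add: power2_norm_eq_inner algebra_simps inner_commute)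
  ultimately show ?thesis using f g unfolding square_integrable_def by auto
qed

lemma square_integrable_diff:
  assumes "square_integrable M f" and "square_integrable M g"
  shows "square_integrable M (\<lambda>\<omega>. f \<omega> - g \<omega>)"
  using square_integrable_add[OF assms(1) square_integrable_scaleR[OF assms(2), of "- 1"]] by simp

lemma (in finite_measure) square_integrable_const: "square_integrable M (\<lambda>_. c)"
  unfolding square_integrable_def by simp

lemma square_integrable_inner_component:
  assumes "square_integrable M f" and "b \<in> Basis"
  shows "integrable M (\<lambda>\<omega>. (f \<omega> \<bullet> b)\<^sup>2)"
proof -
  have "square_integrable M (\<lambda>\<omega>. f \<omega> \<bullet> b)"
    using assms(1) Basis_le_norm[OF assms(2)]
    by (intro square_integrable_bound[OF assms(1)]) (auto simp: square_integrable_def)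
  then show ?thesis by (simp add: square_integrable_def)
qed

text \<open>\<open>vec_cond_exp\<close> acts coordinate by coordinate, so orthogonality in
  expectation is reduced to scalar statements on \<open>Basis\<close>.\<close>

lemma integral_inner_eq_zero:
  assumes "\<And>b. b \<in> Basis \<Longrightarrow> integrable M (\<lambda>\<omega>. (f \<omega> \<bullet> b) * (g \<omega> \<bullet> b))"
    and "\<And>b. b \<in> Basis \<Longrightarrow> (\<integral>\<omega>. (f \<omega> \<bullet> b) * (g \<omega> \<bullet> b) \<partial>M) = 0"
  shows "(\<integral>\<omega>. f \<omega> \<bullet> g \<omega> \<partial>M) = 0"
proof -
  have "(\<lambda>\<omega>. f \<omega> \<bullet> g \<omega>) = (\<lambda>\<omega>. \<Sum>b\<in>Basis. (f \<omega> \<bullet> b) * (g \<omega> \<bullet> b))"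
    by (rule ext, rule euclidean_inner)
  then show ?thesis using assms by simp
qed

lemma integrable_component_mult:
  assumes "square_integrable M f" "square_integrable M g" "b \<in> Basis"
  shows "integrable M (\<lambda>\<omega>. (f \<omega> \<bullet> b) * (g \<omega> \<bullet> b))"
proof -
  have "square_integrable M (\<lambda>\<omega>. f \<omega> \<bullet> b)" "square_integrable M (\<lambda>\<omega>. g \<omega> \<bullet> b)"
    using square_integrable_inner_component[of M _ b] assms
    by (auto simp: square_integrable_def)
  from integrable_inner_square_integrable[OF this] show ?thesis by simp
qed

section \<open>Conditional expectation of vectors and its residual\<close>

lemma borel_measurable_vec_cond_exp [measurable]:
  "vec_cond_exp M F g \<in> borel_measurable F" "vec_cond_exp M F g \<in> borel_measurable M"
  unfolding vec_cond_exp_def[abs_def] by measurable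

lemma vec_cond_exp_inner_Basis:
  "b \<in> Basis \<Longrightarrow> vec_cond_exp M F g \<omega> \<bullet> b = real_cond_exp M F (\<lambda>\<omega>. g \<omega> \<bullet> b) \<omega>"
  unfolding vec_cond_exp_def by (simp add: inner_sum_left_Basis)

context finite_measure_subalgebra
begin

text \<open>The residual has conditional expectation zero, and a factor measurable in
  \<open>F\<close> can be pulled out. As \<open>g\<close> is only integrable, the product of
  \<open>u\<close> with the residual is never split into a product with \<open>g\<close> and one
  with its conditional expectation: integrability is available for the unsplit product.\<close>

lemma integral_inner_vec_cond_exp_residual:
  assumes [measurable]: "u \<in> borel_measurable F" and g: "integrable M g"
    and u: "square_integrable M u"
    and e: "square_integrable M (\<lambda>\<omega>. g \<omega> - vec_cond_exp M F g \<omega>)"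
  shows "(\<integral>\<omega>. u \<omega> \<bullet> (g \<omega> - vec_cond_exp M F g \<omega>) \<partial>M) = 0"
proof (rule integral_inner_eq_zero)
  fix b :: 'b assume b: "b \<in> Basis"
  let ?e = "\<lambda>\<omega>. (g \<omega> - vec_cond_exp M F g \<omega>) \<bullet> b"
  let ?r = "real_cond_exp M F (\<lambda>\<omega>. g \<omega> \<bullet> b)"
  show i: "integrable M (\<lambda>\<omega>. (u \<omega> \<bullet> b) * ?e \<omega>)"
    by (rule integrable_component_mult[OF u e b])
  have [measurable]: "g \<in> borel_measurable M" using g by simp
  have gb: "integrable M (\<lambda>\<omega>. g \<omega> \<bullet> b)" using g by simp
  have e_eq: "?e = (\<lambda>\<omega>. g \<omega> \<bullet> b - ?r \<omega>)"
    using b by (simp add: inner_diff_left vec_cond_exp_inner_Basis)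
  have "AE \<omega> in M. real_cond_exp M F ?e \<omega> = ?r \<omega> - real_cond_exp M F ?r \<omega>"
    unfolding e_eq by (intro real_cond_exp_diff gb real_cond_exp_int)
  moreover have "AE \<omega> in M. real_cond_exp M F ?r \<omega> = ?r \<omega>"
    by (intro real_cond_exp_F_meas real_cond_exp_int gb) measurable
  ultimately have "AE \<omega> in M. (u \<omega> \<bullet> b) * real_cond_exp M F ?e \<omega> = 0"
    by eventually_elim simp
  then have "(\<integral>\<omega>. (u \<omega> \<bullet> b) * real_cond_exp M F ?e \<omega> \<partial>M) = 0"
    by (rule integral_eq_zero_AE)
  moreover have "(\<integral>\<omega>. (u \<omega> \<bullet> b) * real_cond_exp M F ?e \<omega> \<partial>M) = (\<integral>\<omega>. (u \<omega> \<bullet> b) * ?e \<omega> \<partial>M)"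
    by (rule real_cond_exp_intg[OF i]) simp_all
  ultimately show "(\<integral>\<omega>. (u \<omega> \<bullet> b) * ?e \<omega> \<partial>M) = 0" by simp
qed

text \<open>Coordinates are Borel functions of \<open>X\<close> and \<open>Y\<close>, so the scalar
  orthogonality applies on each basis vector; the inner product pairs equal coordinates
  only.\<close>

lemma cond_indep_residuals_orthogonal:
  fixes X Y :: "'a \<Rightarrow> 'b::euclidean_space"
  assumes ind: "cond_indep M F X Y" and X: "integrable M X" and Y: "integrable M Y"
    and eX: "square_integrable M (\<lambda>\<omega>. X \<omega> - vec_cond_exp M F X \<omega>)"
    and eY: "square_integrable M (\<lambda>\<omega>. Y \<omega> - vec_cond_exp M F Y \<omega>)"
  shows "(\<integral>\<omega>. (X \<omega> - vec_cond_exp M F X \<omega>) \<bullet> (Y \<omega> - vec_cond_exp M F Y \<omega>) \<partial>M) = 0"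
proof (rule integral_inner_eq_zero)
  fix b :: 'b assume b: "b \<in> Basis"
  show "integrable M (\<lambda>\<omega>. ((X \<omega> - vec_cond_exp M F X \<omega>) \<bullet> b) * ((Y \<omega> - vec_cond_exp M F Y \<omega>) \<bullet> b))"
    by (rule integrable_component_mult[OF eX eY b])
  have eq: "(Z \<omega> - vec_cond_exp M F Z \<omega>) \<bullet> b = Z \<omega> \<bullet> b - real_cond_exp M F (\<lambda>\<omega>. Z \<omega> \<bullet> b) \<omega>" for Z \<omega>
    using b by (simp add: inner_diff_left vec_cond_exp_inner_Basis)
  show "(\<integral>\<omega>. ((X \<omega> - vec_cond_exp M F X \<omega>) \<bullet> b) * ((Y \<omega> - vec_cond_exp M F Y \<omega>) \<bullet> b) \<partial>M) = 0"
    using cond_indep_centered_orthogonal[OF ind, of "\<lambda>x. x \<bullet> b" "\<lambda>y. y \<bullet> b"] X Y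
      square_integrable_inner_component[OF eX b] square_integrable_inner_component[OF eY b]
    unfolding eq by simp
qed

text \<open>Integrating the conditional bound controls the unconditional second moment. The extended
  form of the conditional expectation matters: a finite bound on it forces the squared residual to
  be integrable, so integrability is a conclusion and not an assumption.\<close>

lemma variance_at_most_square_integrable:
  assumes var: "variance_at_most M F g v" and [measurable]: "g \<in> borel_measurable M" and "v \<ge> 0"
    and prob: "emeasure M (space M) = 1"
  shows "square_integrable M (\<lambda>\<omega>. g \<omega> - vec_cond_exp M F g \<omega>)"
    and "(\<integral>\<omega>. (norm (g \<omega> - vec_cond_exp M F g \<omega>))\<^sup>2 \<partial>M) \<le> v"
proof -
  let ?f = "\<lambda>\<omega>. (norm (g \<omega> - vec_cond_exp M F g \<omega>))\<^sup>2"
  have "(\<integral>\<^sup>+\<omega>. ennreal (?f \<omega>) \<partial>M) = (\<integral>\<^sup>+\<omega>. 1 * nn_cond_exp M F (\<lambda>\<omega>. ennreal (?f \<omega>)) \<omega> \<partial>M)"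
    by (subst nn_cond_exp_intg) simp_all
  also have "\<dots> \<le> (\<integral>\<^sup>+\<omega>. ennreal v \<partial>M)"
    using var unfolding variance_at_most_def by (intro nn_integral_mono_AE) simp
  finally have le: "(\<integral>\<^sup>+\<omega>. ennreal (?f \<omega>) \<partial>M) \<le> ennreal v" by (simp add: prob)
  then have i: "integrable M ?f"
    by (intro integrableI_bounded) (auto simp: less_top[symmetric] top_unique)
  then show "square_integrable M (\<lambda>\<omega>. g \<omega> - vec_cond_exp M F g \<omega>)"
    unfolding square_integrable_def by simp
  show "(\<integral>\<omega>. ?f \<omega> \<partial>M) \<le> v"
    using le nn_integral_eq_integral[OF i] \<open>v \<ge> 0\<close> by simp
qed

end

section \<open>Expected decrease in one step\<close>

text \<open>\<open>h\<close> is bounded below by hypothesis and above by the quadratic bound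
  centered at 0, while a Lipschitz gradient grows at most linearly. A second moment of
  \<open>X\<close> therefore suffices for both claims.\<close>

lemma integrable_smooth_comp:
  fixes h :: "'p::euclidean_space \<Rightarrow> real"
  assumes diff: "\<And>x. h differentiable (at x)" and lip: "L-lipschitz_on UNIV (grad h)"
    and bdd: "bdd_below (range h)" and "prob_space M" and X: "square_integrable M X"
  shows "integrable M (\<lambda>\<omega>. h (X \<omega>))" and "square_integrable M (\<lambda>\<omega>. grad h (X \<omega>))"
proof -
  interpret prob_space M by fact
  have L: "L \<ge> 0" using lip by (rule lipschitz_on_nonneg)
  have [measurable]: "X \<in> borel_measurable M" using X by (simp add: square_integrable_def)
  have [measurable]: "grad h \<in> borel_measurable borel"
    by (intro borel_measurable_continuous_onI lipschitz_on_continuous_on[OF lip])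
  have [measurable]: "h \<in> borel_measurable borel"
    using diff by (intro borel_measurable_continuous_onI continuous_at_imp_continuous_on)
      (auto intro: differentiable_imp_continuous_within)
  have "square_integrable M (\<lambda>\<omega>. grad h (X \<omega>) - grad h 0)"
  proof (rule square_integrable_bound[OF square_integrable_scaleR[OF X, of L]])
    show "AE \<omega> in M. norm (grad h (X \<omega>) - grad h 0) \<le> norm (L *\<^sub>R X \<omega>)"
      using lipschitz_onD[OF lip, of "X _" 0] L by (simp add: dist_norm)
  qed measurable
  from square_integrable_add[OF this square_integrable_const[of "grad h 0"]]
  show "square_integrable M (\<lambda>\<omega>. grad h (X \<omega>))" by simp
  obtain B where B: "\<And>x. B \<le> h x" using bdd by (auto simp: bdd_below_def)
  have i: "integrable M (\<lambda>\<omega>. \<bar>B\<bar> + \<bar>h 0\<bar> + \<bar>grad h 0 \<bullet> X \<omega>\<bar> + L / 2 * (norm (X \<omega>))\<^sup>2)"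
    using integrable_inner_square_integrable[OF square_integrable_const[of "grad h 0"] X] X
    unfolding square_integrable_def by auto
  show "integrable M (\<lambda>\<omega>. h (X \<omega>))"
  proof (rule Bochner_Integration.integrable_bound[OF i])
    have "\<bar>h x\<bar> \<le> \<bar>B\<bar> + \<bar>h 0\<bar> + \<bar>grad h 0 \<bullet> x\<bar> + L / 2 * (norm x)\<^sup>2" for x
    proof -
      have "0 \<le> L / 2 * (norm x)\<^sup>2" using L by simp
      then show ?thesis using descent[OF diff lip, of 0 x] B[of x] by simp
    qed
    then show "AE \<omega> in M. norm (h (X \<omega>)) \<le>
        norm (\<bar>B\<bar> + \<bar>h 0\<bar> + \<bar>grad h 0 \<bullet> X \<omega>\<bar> + L / 2 * (norm (X \<omega>))\<^sup>2)"
      by (auto intro: order_trans[OF _ abs_ge_self])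
  qed measurable
qed

text \<open>Stated for an abstract splitting into a drift \<open>m\<close> measurable in
  \<open>F\<close> and a noise \<open>e\<close> orthogonal to every square-integrable vector
  measurable in \<open>F\<close>. Two test vectors are used: the true gradient removes the
  first-order noise term, and \<open>m\<close> removes the cross term of the squared step.\<close>

lemma (in finite_measure_subalgebra) sgd_step:
  fixes h :: "'p::euclidean_space \<Rightarrow> real" and X m e :: "'a \<Rightarrow> 'p"
  assumes diff: "\<And>x. h differentiable (at x)" and lip: "L-lipschitz_on UNIV (grad h)"
    and bdd: "bdd_below (range h)" and prob: "prob_space M"
    and a: "a \<ge> 0" "a * L \<le> 1"
    and X: "square_integrable M X" and XF: "X \<in> borel_measurable F"
    and mF: "m \<in> borel_measurable F"
    and bias: "AE \<omega> in M. norm (m \<omega> - grad h (X \<omega>)) \<le> D"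
    and e: "square_integrable M e" and var: "(\<integral>\<omega>. (norm (e \<omega>))\<^sup>2 \<partial>M) \<le> V"
    and orth: "\<And>u :: 'a \<Rightarrow> 'p. u \<in> borel_measurable F \<Longrightarrow> square_integrable M u \<Longrightarrow>
      (\<integral>\<omega>. u \<omega> \<bullet> e \<omega> \<partial>M) = 0"
  shows "square_integrable M (\<lambda>\<omega>. X \<omega> - a *\<^sub>R (m \<omega> + e \<omega>))"
    and "(\<integral>\<omega>. h (X \<omega> - a *\<^sub>R (m \<omega> + e \<omega>)) \<partial>M) \<le>
      (\<integral>\<omega>. h (X \<omega>) \<partial>M) - a / 2 * (\<integral>\<omega>. (norm (grad h (X \<omega>)))\<^sup>2 \<partial>M) + a / 2 * D\<^sup>2 + L * a\<^sup>2 / 2 * V"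
proof -
  interpret P: prob_space M by fact
  define G where "G = (\<lambda>\<omega>. grad h (X \<omega>))"
  have L: "L \<ge> 0" using lip by (rule lipschitz_on_nonneg)
  have grad_meas [measurable]: "grad h \<in> borel_measurable borel"
    by (intro borel_measurable_continuous_onI lipschitz_on_continuous_on[OF lip])
  have GF: "G \<in> borel_measurable F" unfolding G_def using XF by measurable
  have G: "square_integrable M G"
    unfolding G_def by (rule integrable_smooth_comp[OF diff lip bdd prob X])
  have GM [measurable]: "G \<in> borel_measurable M" and mM [measurable]: "m \<in> borel_measurable M"
    using GF mF measurable_from_subalg[OF subalg] by blast+
  have bias: "AE \<omega> in M. norm (m \<omega> - G \<omega>) \<le> D" using bias by (simp add: G_def)
  \<comment> \<open>The drift differs from the gradient by a bounded vector; this is how it acquires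
    a second moment.\<close>
  have mG: "square_integrable M (\<lambda>\<omega>. m \<omega> - G \<omega>)"
    by (rule square_integrable_bound[OF square_integrable_const[of D]])
      (use bias in \<open>auto elim!: eventually_mono\<close>)
  have m: "square_integrable M m" using square_integrable_add[OF mG G] by simp
  show S: "square_integrable M (\<lambda>\<omega>. X \<omega> - a *\<^sub>R (m \<omega> + e \<omega>))"
    by (intro square_integrable_diff square_integrable_scaleR square_integrable_add X m e)
  note ints = integrable_inner_square_integrable[OF G m] integrable_inner_square_integrable[OF G e]
    integrable_inner_square_integrable[OF m e]
  have sq: "integrable M (\<lambda>\<omega>. (norm (G \<omega>))\<^sup>2)" "integrable M (\<lambda>\<omega>. (norm (m \<omega>))\<^sup>2)"
    "integrable M (\<lambda>\<omega>. (norm (e \<omega>))\<^sup>2)" "integrable M (\<lambda>\<omega>. (norm (m \<omega> - G \<omega>))\<^sup>2)"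
    using G m e mG by (simp_all add: square_integrable_def)
  have hX: "integrable M (\<lambda>\<omega>. h (X \<omega>))"
    by (rule integrable_smooth_comp[OF diff lip bdd prob X])
  have "(\<integral>\<omega>. h (X \<omega> - a *\<^sub>R (m \<omega> + e \<omega>)) \<partial>M) \<le>
      (\<integral>\<omega>. h (X \<omega>) - a * (G \<omega> \<bullet> m \<omega>) - a * (G \<omega> \<bullet> e \<omega>) +
        L / 2 * a\<^sup>2 * ((norm (m \<omega>))\<^sup>2 + 2 * (m \<omega> \<bullet> e \<omega>) + (norm (e \<omega>))\<^sup>2) \<partial>M)"
  proof (rule integral_mono)
    show "integrable M (\<lambda>\<omega>. h (X \<omega> - a *\<^sub>R (m \<omega> + e \<omega>)))"
      by (rule integrable_smooth_comp[OF diff lip bdd prob S])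
    show "integrable M (\<lambda>\<omega>. h (X \<omega>) - a * (G \<omega> \<bullet> m \<omega>) - a * (G \<omega> \<bullet> e \<omega>) +
        L / 2 * a\<^sup>2 * ((norm (m \<omega>))\<^sup>2 + 2 * (m \<omega> \<bullet> e \<omega>) + (norm (e \<omega>))\<^sup>2))"
      using hX ints sq by simp
    fix \<omega>
    let ?s = "(- a) *\<^sub>R (m \<omega> + e \<omega>)"
    have "(norm ?s)\<^sup>2 = a\<^sup>2 * ((norm (m \<omega>))\<^sup>2 + 2 * (m \<omega> \<bullet> e \<omega>) + (norm (e \<omega>))\<^sup>2)"
      unfolding power2_norm_eq_inner
      by (simp add: inner_add_left inner_add_right inner_commute power2_eq_square algebra_simps)
    moreover have "G \<omega> \<bullet> ?s = - a * (G \<omega> \<bullet> m \<omega>) - a * (G \<omega> \<bullet> e \<omega>)"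
      by (simp add: inner_add_right algebra_simps)
    moreover have "h (X \<omega> + ?s) \<le> h (X \<omega>) + G \<omega> \<bullet> ?s + L / 2 * (norm ?s)\<^sup>2"
      unfolding G_def by (rule descent[OF diff lip])
    ultimately show "h (X \<omega> - a *\<^sub>R (m \<omega> + e \<omega>)) \<le>
        h (X \<omega>) - a * (G \<omega> \<bullet> m \<omega>) - a * (G \<omega> \<bullet> e \<omega>) +
        L / 2 * a\<^sup>2 * ((norm (m \<omega>))\<^sup>2 + 2 * (m \<omega> \<bullet> e \<omega>) + (norm (e \<omega>))\<^sup>2)"
      by (simp add: mult.assoc)
  qed
  also have "\<dots> = (\<integral>\<omega>. h (X \<omega>) \<partial>M) - a * (\<integral>\<omega>. G \<omega> \<bullet> m \<omega> \<partial>M) +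
      L / 2 * a\<^sup>2 * ((\<integral>\<omega>. (norm (m \<omega>))\<^sup>2 \<partial>M) + (\<integral>\<omega>. (norm (e \<omega>))\<^sup>2 \<partial>M))"
    using hX ints sq orth[OF GF G] orth[OF mF m] by simp
  finally have step: "(\<integral>\<omega>. h (X \<omega> - a *\<^sub>R (m \<omega> + e \<omega>)) \<partial>M) \<le>
      (\<integral>\<omega>. h (X \<omega>) \<partial>M) - a * (\<integral>\<omega>. G \<omega> \<bullet> m \<omega> \<partial>M) +
      L / 2 * a\<^sup>2 * ((\<integral>\<omega>. (norm (m \<omega>))\<^sup>2 \<partial>M) + (\<integral>\<omega>. (norm (e \<omega>))\<^sup>2 \<partial>M))" .
  \<comment> \<open>Polarization trades the inner product of gradient and drift for squared norms,
    so the bias enters only through its square.\<close>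
  have "(\<integral>\<omega>. (norm (m \<omega> - G \<omega>))\<^sup>2 \<partial>M) =
      (\<integral>\<omega>. (norm (m \<omega>))\<^sup>2 + (norm (G \<omega>))\<^sup>2 - 2 * (G \<omega> \<bullet> m \<omega>) \<partial>M)"
    by (intro Bochner_Integration.integral_cong refl)
      (simp add: power2_norm_eq_inner inner_diff_left inner_diff_right inner_commute)
  also have "\<dots> = (\<integral>\<omega>. (norm (m \<omega>))\<^sup>2 \<partial>M) + (\<integral>\<omega>. (norm (G \<omega>))\<^sup>2 \<partial>M) - 2 * (\<integral>\<omega>. G \<omega> \<bullet> m \<omega> \<partial>M)"
    using ints sq by simp
  finally have inner: "2 * (\<integral>\<omega>. G \<omega> \<bullet> m \<omega> \<partial>M) = (\<integral>\<omega>. (norm (m \<omega>))\<^sup>2 \<partial>M) +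
      (\<integral>\<omega>. (norm (G \<omega>))\<^sup>2 \<partial>M) - (\<integral>\<omega>. (norm (m \<omega> - G \<omega>))\<^sup>2 \<partial>M)" by simp
  have "(\<integral>\<omega>. (norm (m \<omega> - G \<omega>))\<^sup>2 \<partial>M) \<le> (\<integral>\<omega>. D\<^sup>2 \<partial>M)"
    using bias by (intro integral_mono_AE sq) (auto elim!: eventually_mono intro: power_mono)
  then have biasI: "(\<integral>\<omega>. (norm (m \<omega> - G \<omega>))\<^sup>2 \<partial>M) \<le> D\<^sup>2" by (simp add: P.prob_space)
  \<comment> \<open>The quadratic term in \<open>m\<close> from the smoothness bound is absorbed by
    the \<open>m\<close> term from polarization; this is where \<open>a * L \<le> 1\<close> is
    needed.\<close>
  have "L / 2 * a\<^sup>2 * (\<integral>\<omega>. (norm (m \<omega>))\<^sup>2 \<partial>M) = (a * L) * (a / 2 * (\<integral>\<omega>. (norm (m \<omega>))\<^sup>2 \<partial>M))"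
    by (simp add: power2_eq_square)
  also have "\<dots> \<le> 1 * (a / 2 * (\<integral>\<omega>. (norm (m \<omega>))\<^sup>2 \<partial>M))"
    using a by (intro mult_right_mono) auto
  finally have m_le: "L / 2 * a\<^sup>2 * (\<integral>\<omega>. (norm (m \<omega>))\<^sup>2 \<partial>M) \<le> a / 2 * (\<integral>\<omega>. (norm (m \<omega>))\<^sup>2 \<partial>M)"
    by simp
  have e_le: "L / 2 * a\<^sup>2 * (\<integral>\<omega>. (norm (e \<omega>))\<^sup>2 \<partial>M) \<le> L / 2 * a\<^sup>2 * V"
    using var L by (intro mult_left_mono) auto
  have b_le: "a / 2 * (\<integral>\<omega>. (norm (m \<omega> - G \<omega>))\<^sup>2 \<partial>M) \<le> a / 2 * D\<^sup>2"
    using biasI a by (intro mult_left_mono) auto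
  have "a * (\<integral>\<omega>. G \<omega> \<bullet> m \<omega> \<partial>M) = a / 2 * (2 * (\<integral>\<omega>. G \<omega> \<bullet> m \<omega> \<partial>M))" by simp
  also have "\<dots> = a / 2 * (\<integral>\<omega>. (norm (m \<omega>))\<^sup>2 \<partial>M) + a / 2 * (\<integral>\<omega>. (norm (G \<omega>))\<^sup>2 \<partial>M) -
      a / 2 * (\<integral>\<omega>. (norm (m \<omega> - G \<omega>))\<^sup>2 \<partial>M)"
    unfolding inner by (simp only: ring_distribs)
  finally show "(\<integral>\<omega>. h (X \<omega> - a *\<^sub>R (m \<omega> + e \<omega>)) \<partial>M) \<le> (\<integral>\<omega>. h (X \<omega>) \<partial>M) -
      a / 2 * (\<integral>\<omega>. (norm (grad h (X \<omega>)))\<^sup>2 \<partial>M) + a / 2 * D\<^sup>2 + L * a\<^sup>2 / 2 * V"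
    using step m_le e_le b_le by (simp add: G_def distrib_left)
qed

section \<open>Summing over the iterations\<close>

lemma grad_linear_combination:
  fixes f g :: "'a::euclidean_space \<Rightarrow> real"
  assumes "f differentiable (at x)" and "g differentiable (at x)"
  shows "grad (\<lambda>x. 2 * f x - g x - k) x = 2 *\<^sub>R grad f x - grad g x"
proof (rule grad_eq)
  have "GDERIV (\<lambda>x. (f x + f x) - g x - k) x :> (grad f x + grad f x) - grad g x - 0"
    by (intro GDERIV_diff GDERIV_add GDERIV_const GDERIV_grad assms)
  then show "GDERIV (\<lambda>x. 2 * f x - g x - k) x :> 2 *\<^sub>R grad f x - grad g x"
    by (simp add: scaleR_2)
qed

text \<open>Of the loss, only its form as twice one function minus another minus a constant enters;
  \<open>k\<close> stands for the self-term of the target, which does not depend on the parameter.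
  The first claim licenses the passage from Bochner integrals to nonnegative ones in the final
  statement.\<close>

lemma sgd_sum_bound:
  fixes h f1 f2 :: "'p::euclidean_space \<Rightarrow> real"
  assumes h: "h = (\<lambda>x. 2 * f1 x - f2 x - k)"
    and diff: "\<And>x. h differentiable (at x)" and lip: "L-lipschitz_on UNIV (grad h)"
    and bdd: "bdd_below (range h)" and "prob_space M"
    and \<theta>0: "\<And>\<omega>. \<omega> \<in> space M \<Longrightarrow> \<theta> 0 \<omega> = x0"
    and \<theta>_Suc: "\<And>t \<omega>. t < T \<Longrightarrow> \<omega> \<in> space M \<Longrightarrow>
      \<theta> (Suc t) \<omega> = \<theta> t \<omega> - a *\<^sub>R (2 *\<^sub>R g1 t \<omega> - g2 t \<omega>)"
    and \<pi>: "\<And>t. t < T \<Longrightarrow> \<pi>1 t \<in> M \<rightarrow>\<^sub>M measure_algebra borel"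
      "\<And>t. t < T \<Longrightarrow> \<pi>2 t \<in> M \<rightarrow>\<^sub>M measure_algebra borel"
    and g: "\<And>t. t < T \<Longrightarrow> integrable M (g1 t)" "\<And>t. t < T \<Longrightarrow> integrable M (g2 t)"
    and ind: "\<And>t. t < T \<Longrightarrow> cond_indep M (history M \<theta> \<pi>1 \<pi>2 t) (g1 t) (g2 t)"
    and bias1: "\<And>t. t < T \<Longrightarrow> bias_at_most M (history M \<theta> \<pi>1 \<pi>2 t) f1 (\<theta> t) (g1 t) \<delta>"
    and bias2: "\<And>t. t < T \<Longrightarrow> bias_at_most M (history M \<theta> \<pi>1 \<pi>2 t) f2 (\<theta> t) (g2 t) \<delta>"
    and var1: "\<And>t. t < T \<Longrightarrow> variance_at_most M (history M \<theta> \<pi>1 \<pi>2 t) (g1 t) (\<sigma>\<^sup>2)"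
    and var2: "\<And>t. t < T \<Longrightarrow> variance_at_most M (history M \<theta> \<pi>1 \<pi>2 t) (g2 t) (\<sigma>\<^sup>2)"
    and a: "a \<ge> 0" "a * L \<le> 1"
  shows "\<And>t. t < T \<Longrightarrow> integrable M (\<lambda>\<omega>. (norm (grad h (\<theta> t \<omega>)))\<^sup>2)"
    and "a / 2 * (\<Sum>t<T. \<integral>\<omega>. (norm (grad h (\<theta> t \<omega>)))\<^sup>2 \<partial>M) \<le>
      h x0 - (INF x. h x) + T * (a / 2 * (3 * \<delta>)\<^sup>2 + L * a\<^sup>2 / 2 * (5 * \<sigma>\<^sup>2))"
proof -
  interpret prob_space M by fact
  define K where "K = a / 2 * (3 * \<delta>)\<^sup>2 + L * a\<^sup>2 / 2 * (5 * \<sigma>\<^sup>2)"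
  \<comment> \<open>This has to precede any conditioning: measurability of the iterates is what
    makes the history a subalgebra of \<open>M\<close>.\<close>
  have \<theta>_meas: "\<theta> t \<in> borel_measurable M" if "t \<le> T" for t
    using that
  proof (induction t)
    case 0
    show ?case using \<theta>0 by (simp cong: measurable_cong)
  next
    case (Suc t)
    then have [measurable]: "\<theta> t \<in> borel_measurable M" "g1 t \<in> borel_measurable M"
      "g2 t \<in> borel_measurable M" using g[of t] by auto
    have "(\<lambda>\<omega>. \<theta> t \<omega> - a *\<^sub>R (2 *\<^sub>R g1 t \<omega> - g2 t \<omega>)) \<in> borel_measurable M" by measurable
    then show ?case using Suc.prems \<theta>_Suc[of t] by (simp cong: measurable_cong)
  qed
  have step: "square_integrable M (\<theta> (Suc t)) \<and>
      (\<integral>\<omega>. h (\<theta> (Suc t) \<omega>) \<partial>M) \<le> (\<integral>\<omega>. h (\<theta> t \<omega>) \<partial>M) -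
        a / 2 * (\<integral>\<omega>. (norm (grad h (\<theta> t \<omega>)))\<^sup>2 \<partial>M) + K"
    if t: "t < T" and X: "square_integrable M (\<theta> t)" for t
  proof -
    define F where "F = history M \<theta> \<pi>1 \<pi>2 t"
    have subalg: "subalgebra M F" and XF: "\<theta> t \<in> borel_measurable F"
      using subalgebra_history[of t \<theta> M \<pi>1 \<pi>2] \<theta>_meas \<pi> t unfolding F_def by auto
    interpret finite_measure_subalgebra M F by unfold_locales fact
    define m1 m2 where "m1 = vec_cond_exp M F (g1 t)" and "m2 = vec_cond_exp M F (g2 t)"
    define e1 e2 where "e1 = (\<lambda>\<omega>. g1 t \<omega> - m1 \<omega>)" and "e2 = (\<lambda>\<omega>. g2 t \<omega> - m2 \<omega>)"
    note [measurable] = borel_measurable_integrable[OF g(1)[OF t]]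
      borel_measurable_integrable[OF g(2)[OF t]]
    have v1: "variance_at_most M F (g1 t) (\<sigma>\<^sup>2)" and v2: "variance_at_most M F (g2 t) (\<sigma>\<^sup>2)"
      using var1[OF t] var2[OF t] by (simp_all add: F_def)
    have e1: "square_integrable M e1" "(\<integral>\<omega>. (norm (e1 \<omega>))\<^sup>2 \<partial>M) \<le> \<sigma>\<^sup>2"
      using variance_at_most_square_integrable[OF v1] by (simp_all add: e1_def m1_def emeasure_space_1)
    have e2: "square_integrable M e2" "(\<integral>\<omega>. (norm (e2 \<omega>))\<^sup>2 \<partial>M) \<le> \<sigma>\<^sup>2"
      using variance_at_most_square_integrable[OF v2] by (simp_all add: e2_def m2_def emeasure_space_1)
    have e12: "(\<integral>\<omega>. e1 \<omega> \<bullet> e2 \<omega> \<partial>M) = 0"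
      using cond_indep_residuals_orthogonal[OF ind[OF t, folded F_def] g(1)[OF t] g(2)[OF t]]
        e1(1) e2(1) by (simp add: e1_def e2_def m1_def m2_def)
    define m e where "m = (\<lambda>\<omega>. 2 *\<^sub>R m1 \<omega> - m2 \<omega>)" and "e = (\<lambda>\<omega>. 2 *\<^sub>R e1 \<omega> - e2 \<omega>)"
    have mF: "m \<in> borel_measurable F" unfolding m_def m1_def m2_def by measurable
    have e: "square_integrable M e"
      unfolding e_def by (intro square_integrable_diff square_integrable_scaleR e1 e2)
    have "(\<integral>\<omega>. (norm (e \<omega>))\<^sup>2 \<partial>M) =
        (\<integral>\<omega>. 4 * (norm (e1 \<omega>))\<^sup>2 + (norm (e2 \<omega>))\<^sup>2 - 4 * (e1 \<omega> \<bullet> e2 \<omega>) \<partial>M)"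
      unfolding e_def power2_norm_eq_inner
      by (intro Bochner_Integration.integral_cong refl)
        (simp add: inner_diff_left inner_diff_right inner_commute)
    also have "\<dots> = 4 * (\<integral>\<omega>. (norm (e1 \<omega>))\<^sup>2 \<partial>M) + (\<integral>\<omega>. (norm (e2 \<omega>))\<^sup>2 \<partial>M)"
      using e1(1) e2(1) integrable_inner_square_integrable[OF e1(1) e2(1)] e12
      by (simp add: square_integrable_def)
    finally have var: "(\<integral>\<omega>. (norm (e \<omega>))\<^sup>2 \<partial>M) \<le> 5 * \<sigma>\<^sup>2" using e1(2) e2(2) by simp
    have orth: "(\<integral>\<omega>. u \<omega> \<bullet> e \<omega> \<partial>M) = 0"
      if uF: "u \<in> borel_measurable F" and u: "square_integrable M u" for u
    proof -
      have "(\<integral>\<omega>. u \<omega> \<bullet> e1 \<omega> \<partial>M) = 0" "(\<integral>\<omega>. u \<omega> \<bullet> e2 \<omega> \<partial>M) = 0"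
        using integral_inner_vec_cond_exp_residual[OF uF g(1)[OF t] u]
          integral_inner_vec_cond_exp_residual[OF uF g(2)[OF t] u] e1(1) e2(1)
        by (simp_all add: e1_def e2_def m1_def m2_def)
      then show ?thesis
        using integrable_inner_square_integrable[OF u e1(1)] integrable_inner_square_integrable[OF u e2(1)]
        by (simp add: e_def inner_diff_right)
    qed
    \<comment> \<open>The two terms of the loss are known to be differentiable at the iterate only
      almost surely, as part of \<open>bias_at_most\<close>, so the gradient of \<open>h\<close> is
      split under the almost-everywhere quantifier.\<close>
    have bias: "AE \<omega> in M. norm (m \<omega> - grad h (\<theta> t \<omega>)) \<le> 3 * \<delta>"
      using bias1[OF t] bias2[OF t] unfolding bias_at_most_def
    proof eventually_elim
      case (elim \<omega>)
      then have "grad h (\<theta> t \<omega>) = 2 *\<^sub>R grad f1 (\<theta> t \<omega>) - grad f2 (\<theta> t \<omega>)"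
        unfolding h by (intro grad_linear_combination) auto
      then have "m \<omega> - grad h (\<theta> t \<omega>) =
          2 *\<^sub>R (m1 \<omega> - grad f1 (\<theta> t \<omega>)) - (m2 \<omega> - grad f2 (\<theta> t \<omega>))"
        by (simp add: m_def algebra_simps)
      also have "norm \<dots> \<le> 2 * norm (m1 \<omega> - grad f1 (\<theta> t \<omega>)) + norm (m2 \<omega> - grad f2 (\<theta> t \<omega>))"
        by (rule order_trans[OF norm_triangle_ineq4]) simp
      also have "\<dots> \<le> 2 * \<delta> + \<delta>"
        using elim by (intro add_mono mult_left_mono) (auto simp: m1_def m2_def F_def)
      finally show ?case by simp
    qed
    have eq: "\<theta> (Suc t) \<omega> = \<theta> t \<omega> - a *\<^sub>R (m \<omega> + e \<omega>)" if "\<omega> \<in> space M" for \<omega>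
      using \<theta>_Suc[OF t that] by (simp add: m_def e_def e1_def e2_def algebra_simps)
    note S = sgd_step[OF diff lip bdd \<open>prob_space M\<close> a X XF mF bias e var orth]
    have "square_integrable M (\<theta> (Suc t))"
    proof -
      have "norm (\<theta> (Suc t) \<omega>) \<le> norm (\<theta> t \<omega> - a *\<^sub>R (m \<omega> + e \<omega>))" if "\<omega> \<in> space M" for \<omega>
        using eq[OF that] by simp
      then show ?thesis
        using t by (intro square_integrable_bound[OF S(1) \<theta>_meas] AE_I2) simp_all
    qed
    moreover have "(\<integral>\<omega>. h (\<theta> (Suc t) \<omega>) \<partial>M) = (\<integral>\<omega>. h (\<theta> t \<omega> - a *\<^sub>R (m \<omega> + e \<omega>)) \<partial>M)"
      by (intro Bochner_Integration.integral_cong refl) (simp add: eq)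
    ultimately show ?thesis using S(2) by (simp add: K_def)
  qed
  \<comment> \<open>The second moment is carried through the induction because the next step
    requires it; the current expected value stays on the left, so that successive steps
    telescope.\<close>
  have *: "square_integrable M (\<theta> n) \<and>
      (\<integral>\<omega>. h (\<theta> n \<omega>) \<partial>M) + a / 2 * (\<Sum>t<n. \<integral>\<omega>. (norm (grad h (\<theta> t \<omega>)))\<^sup>2 \<partial>M) \<le> h x0 + n * K"
    if "n \<le> T" for n
    using that
  proof (induction n)
    case 0
    have "square_integrable M (\<theta> 0)"
      by (rule square_integrable_bound[OF square_integrable_const[of x0] \<theta>_meas])
        (simp_all add: \<theta>0)
    moreover have "(\<integral>\<omega>. h (\<theta> 0 \<omega>) \<partial>M) = (\<integral>\<omega>. h x0 \<partial>M)"
      by (intro Bochner_Integration.integral_cong refl) (simp add: \<theta>0)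
    ultimately show ?case by (simp add: prob_space)
  next
    case (Suc n)
    then show ?case using step[of n] by (simp add: distrib_left distrib_right)
  qed
  show "integrable M (\<lambda>\<omega>. (norm (grad h (\<theta> t \<omega>)))\<^sup>2)" if "t < T" for t
    using integrable_smooth_comp(2)[OF diff lip bdd \<open>prob_space M\<close>, of "\<theta> t"] *[of t] that
    by (simp add: square_integrable_def)
  have "(INF x. h x) \<le> (\<integral>\<omega>. h (\<theta> T \<omega>) \<partial>M)"
    using *[of T] bdd
    by (intro integral_ge_const integrable_smooth_comp[OF diff lip bdd \<open>prob_space M\<close>] AE_I2)
      (auto intro: cINF_lower)
  then show "a / 2 * (\<Sum>t<T. \<integral>\<omega>. (norm (grad h (\<theta> t \<omega>)))\<^sup>2 \<partial>M) \<le>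
      h x0 - (INF x. h x) + T * (a / 2 * (3 * \<delta>)\<^sup>2 + L * a\<^sup>2 / 2 * (5 * \<sigma>\<^sup>2))"
    using *[of T] unfolding K_def[symmetric] by simp
qed

section \<open>Choice of the step size\<close>

theorem corollary4p3p1:
  fixes R :: regularizer
    and c :: "(real ^ 'd) \<times> (real ^ 'd) \<Rightarrow> real"
    and lam :: real
    and q :: "'x measure"
    and p :: "(real ^ 'd) measure"
    and G :: "'p::euclidean_space \<Rightarrow> 'x \<Rightarrow> real ^ 'd"
    and h :: "'p \<Rightarrow> real"
    and M :: "'w measure"
    and \<theta> :: "nat \<Rightarrow> 'w \<Rightarrow> 'p"
    and \<theta>\<^sub>0 :: 'p
    and \<pi>1 \<pi>2 :: "nat \<Rightarrow> 'w \<Rightarrow> ((real ^ 'd) \<times> (real ^ 'd)) measure"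
    and g1 g2 :: "nat \<Rightarrow> 'w \<Rightarrow> 'p"
    and \<alpha> :: "nat \<Rightarrow> real"
    and T :: nat
    and L \<Delta> \<delta> \<sigma> \<delta>hat \<sigma>hat :: real
  assumes "c \<in> borel_measurable borel" and "lam > 0"
    and "prob_space q"
    and "prob_space p" and "sets p = sets borel"
    and "\<And>\<phi>. G \<phi> \<in> q \<rightarrow>\<^sub>M borel" and "\<And>\<phi>. inj_on (G \<phi>) (space q)"
    and "h = sinkhorn_loss R c lam q p G"
    and "\<And>\<phi>. h differentiable (at \<phi>)"
    and "L > 0" and "L-lipschitz_on UNIV (grad h)"
    and "bdd_below (range h)" and "\<Delta> = h \<theta>\<^sub>0 - (INF \<phi>. h \<phi>)"
    and "prob_space M" and "T > 0"
    and "\<And>\<omega>. \<omega> \<in> space M \<Longrightarrow> \<theta> 0 \<omega> = \<theta>\<^sub>0"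
    and "\<And>t \<omega>. t < T \<Longrightarrow> \<omega> \<in> space M \<Longrightarrow>
           \<theta> (Suc t) \<omega> = \<theta> t \<omega> - \<alpha> t *\<^sub>R (2 *\<^sub>R g1 t \<omega> - g2 t \<omega>)"
    and "\<And>t. t < T \<Longrightarrow> \<pi>1 t \<in> M \<rightarrow>\<^sub>M measure_algebra borel"
    and "\<And>t. t < T \<Longrightarrow> \<pi>2 t \<in> M \<rightarrow>\<^sub>M measure_algebra borel"
    and "\<And>t. t < T \<Longrightarrow> integrable M (g1 t)"
    and "\<And>t. t < T \<Longrightarrow> integrable M (g2 t)"
    and "\<And>t. t < T \<Longrightarrow> cond_indep M (history M \<theta> \<pi>1 \<pi>2 t) (g1 t) (g2 t)"
    and "\<And>t. t < T \<Longrightarrow> bias_at_most M (history M \<theta> \<pi>1 \<pi>2 t)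
           (\<lambda>\<phi>. sharp_ot R c lam (distr q borel (G \<phi>)) p) (\<theta> t) (g1 t) \<delta>"
    and "\<And>t. t < T \<Longrightarrow> bias_at_most M (history M \<theta> \<pi>1 \<pi>2 t)
           (\<lambda>\<phi>. sharp_ot R c lam (distr q borel (G \<phi>)) (distr q borel (G \<phi>))) (\<theta> t) (g2 t) \<delta>"
    and "\<sigma> > 0"
    and "\<And>t. t < T \<Longrightarrow> variance_at_most M (history M \<theta> \<pi>1 \<pi>2 t) (g1 t) (\<sigma>\<^sup>2)"
    and "\<And>t. t < T \<Longrightarrow> variance_at_most M (history M \<theta> \<pi>1 \<pi>2 t) (g2 t) (\<sigma>\<^sup>2)"
    and "\<delta>hat = 3 * \<delta>"
    and "\<sigma>hat > 0" and "\<sigma>hat\<^sup>2 = 5 * \<sigma>\<^sup>2"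
  shows "(real T < 2 * \<Delta> * L / \<sigma>hat\<^sup>2 \<and> (\<forall>t<T. \<alpha> t = 1 / L) \<longrightarrow>
            (\<Sum>t<T. \<integral>\<^sup>+ \<omega>. ennreal ((norm (grad h (\<theta> t \<omega>)))\<^sup>2) \<partial>M) / of_nat T
            \<le> ennreal (2 * L * \<Delta> / real T + \<delta>hat\<^sup>2 + \<sigma>hat\<^sup>2)) \<and>
         (real T \<ge> 2 * \<Delta> * L / \<sigma>hat\<^sup>2 \<and>
            (\<forall>t<T. \<alpha> t = sqrt (2 * \<Delta> / (L * \<sigma>hat\<^sup>2 * real T))) \<longrightarrow>
            (\<Sum>t<T. \<integral>\<^sup>+ \<omega>. ennreal ((norm (grad h (\<theta> t \<omega>)))\<^sup>2) \<partial>M) / of_nat T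
            \<le> ennreal (\<sigma>hat * sqrt (8 * L * \<Delta> / real T) + \<delta>hat\<^sup>2))"
proof -
  interpret prob_space M by fact
  let ?s = "\<Sum>t<T. \<integral>\<^sup>+ \<omega>. ennreal ((norm (grad h (\<theta> t \<omega>)))\<^sup>2) \<partial>M"
  have \<Delta>: "\<Delta> \<ge> 0"
    unfolding assms(13) using cINF_lower[OF assms(12), of \<theta>\<^sub>0] by simp
  \<comment> \<open>For a constant step \<open>a\<close> one term of the bound decreases in
    \<open>a\<close> and one increases. For \<Delta> > 0 their sum is smallest at
    \<open>sqrt (2 * \<Delta> / (L * \<sigma>hat\<^sup>2 * real T))\<close>, which is at most
    \<open>1 / L\<close> exactly when
    \<open>real T \<ge> 2 * \<Delta> * L / \<sigma>hat\<^sup>2\<close>. This is the origin of the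
    two regimes: below the threshold the best admissible step is \<open>1 / L\<close>.\<close>
  have rate: "?s / of_nat T \<le> ennreal (2 * \<Delta> / (a * real T) + \<delta>hat\<^sup>2 + L * a * \<sigma>hat\<^sup>2)"
    if a: "a > 0" "a * L \<le> 1" and \<alpha>: "\<forall>t<T. \<alpha> t = a" for a
  proof -
    let ?I = "\<lambda>t. \<integral>\<omega>. (norm (grad h (\<theta> t \<omega>)))\<^sup>2 \<partial>M"
    have hk: "h = (\<lambda>\<phi>. 2 * sharp_ot R c lam (distr q borel (G \<phi>)) p -
        sharp_ot R c lam (distr q borel (G \<phi>)) (distr q borel (G \<phi>)) - sharp_ot R c lam p p)"
      unfolding assms(8) sinkhorn_loss_def ..
    have \<theta>_Suc: "\<theta> (Suc t) \<omega> = \<theta> t \<omega> - a *\<^sub>R (2 *\<^sub>R g1 t \<omega> - g2 t \<omega>)"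
      if "t < T" "\<omega> \<in> space M" for t \<omega>
      using assms(17)[OF that] \<alpha> that by simp
    note B = sgd_sum_bound[where \<theta> = \<theta> and ?x0.0 = \<theta>\<^sub>0 and T = T and a = a and \<delta> = \<delta> and \<sigma> = \<sigma>,
        OF hk assms(9,11,12,14,16) \<theta>_Suc assms(18-24,26,27) less_imp_le[OF a(1)] a(2)]
    have T: "real T > 0" using \<open>T > 0\<close> by simp
    have "a / 2 * (\<Sum>t<T. ?I t) \<le> \<Delta> + T * (a / 2 * \<delta>hat\<^sup>2 + L * a\<^sup>2 / 2 * \<sigma>hat\<^sup>2)"
      using B(2) by (simp add: assms(13,28,30))
    then have "(\<Sum>t<T. ?I t) / T \<le> 2 * \<Delta> / (a * real T) + \<delta>hat\<^sup>2 + L * a * \<sigma>hat\<^sup>2"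
      using a(1) T by (simp add: field_simps power2_eq_square)
    moreover have "?s = ennreal (\<Sum>t<T. ?I t)"
    proof -
      have "?s = (\<Sum>t<T. ennreal (?I t))"
        by (intro sum.cong refl nn_integral_eq_integral B(1)) simp_all
      then show ?thesis by (simp add: sum_ennreal)
    qed
    then have "?s / of_nat T = ennreal ((\<Sum>t<T. ?I t) / T)"
      using T by (simp add: ennreal_of_nat_eq_real_of_nat divide_ennreal sum_nonneg)
    ultimately show ?thesis by (simp add: ennreal_leI)
  qed
  show ?thesis
  proof (intro conjI impI; elim conjE)
    assume "\<forall>t<T. \<alpha> t = 1 / L"
    then have "?s / of_nat T \<le> ennreal (2 * \<Delta> / (1 / L * real T) + \<delta>hat\<^sup>2 + L * (1 / L) * \<sigma>hat\<^sup>2)"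
      using \<open>L > 0\<close> by (intro rate) auto
    then show "?s / of_nat T \<le> ennreal (2 * L * \<Delta> / real T + \<delta>hat\<^sup>2 + \<sigma>hat\<^sup>2)"
      using \<open>L > 0\<close> by (simp add: mult_ac)
  next
    define a where "a = sqrt (2 * \<Delta> / (L * \<sigma>hat\<^sup>2 * real T))"
    assume large: "2 * \<Delta> * L / \<sigma>hat\<^sup>2 \<le> real T"
      and "\<forall>t<T. \<alpha> t = sqrt (2 * \<Delta> / (L * \<sigma>hat\<^sup>2 * real T))"
    then have \<alpha>: "\<forall>t<T. \<alpha> t = a" by (simp add: a_def)
    have T: "real T > 0" using \<open>T > 0\<close> by simp
    show "?s / of_nat T \<le> ennreal (\<sigma>hat * sqrt (8 * L * \<Delta> / real T) + \<delta>hat\<^sup>2)"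
    proof (cases "\<Delta> = 0")
      case True
      \<comment> \<open>The step size is then 0, and the iterates stay at \<open>\<theta>\<^sub>0\<close>, a minimizer of \<open>h\<close>.\<close>
      have "a = 0" by (simp add: a_def True)
      have const: "\<theta> t \<omega> = \<theta>\<^sub>0" if "t \<le> T" "\<omega> \<in> space M" for t \<omega>
        using that(1) by (induction t) (simp_all add: assms(16,17) that(2) \<alpha> \<open>a = 0\<close>)
      have "grad h \<theta>\<^sub>0 = 0"
        using norm_grad_le[OF assms(9,11,10,12), of \<theta>\<^sub>0] True assms(13) by simp
      then have "(\<integral>\<^sup>+ \<omega>. ennreal ((norm (grad h (\<theta> t \<omega>)))\<^sup>2) \<partial>M) = 0" if "t < T" for t
        using that by (simp add: const cong: nn_integral_cong)
      then show ?thesis by simp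
    next
      case False
      then have \<Delta>': "\<Delta> > 0" using \<Delta> by simp
      have a: "a > 0" using \<Delta>' T \<open>L > 0\<close> \<open>\<sigma>hat > 0\<close> by (simp add: a_def)
      have a2: "a\<^sup>2 = 2 * \<Delta> / (L * \<sigma>hat\<^sup>2 * real T)"
        using \<Delta> T \<open>L > 0\<close> by (simp add: a_def)
      have "(a * L)\<^sup>2 = (2 * \<Delta> * L / \<sigma>hat\<^sup>2) / real T"
        using \<open>L > 0\<close> by (simp add: power_mult_distrib a2) (simp add: power2_eq_square)
      also have "\<dots> \<le> 1\<^sup>2"
        using large T by (simp only: power_one divide_le_eq_1_pos)
      finally have aL: "a * L \<le> 1" by (rule power2_le_imp_le) simp
      \<comment> \<open>At this step size the two terms depending on \<open>a\<close> are equal, so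
        their sum is twice one of them; the doubling turns the factor 2 under the root into
        8.\<close>
      have half: "2 * \<Delta> / (a * real T) = L * a * \<sigma>hat\<^sup>2"
      proof -
        have "L * a * \<sigma>hat\<^sup>2 * (a * real T) = L * \<sigma>hat\<^sup>2 * real T * a\<^sup>2"
          by (simp add: power2_eq_square)
        also have "\<dots> = 2 * \<Delta>" using T \<open>L > 0\<close> \<open>\<sigma>hat > 0\<close> unfolding a2 by simp
        finally show ?thesis using a T by (simp add: divide_eq_eq)
      qed
      have "2 * (L * a * \<sigma>hat\<^sup>2) = \<sigma>hat * sqrt (8 * L * \<Delta> / real T)"
      proof (rule power2_eq_imp_eq)
        have "(2 * (L * a * \<sigma>hat\<^sup>2))\<^sup>2 = 4 * L\<^sup>2 * \<sigma>hat ^ 4 * a\<^sup>2"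
          by (simp add: power_mult_distrib)
        also have "\<dots> = \<sigma>hat\<^sup>2 * (8 * L * \<Delta> / real T)"
          using T \<open>L > 0\<close> \<open>\<sigma>hat > 0\<close> unfolding a2 by (simp add: field_simps power2_eq_square power4_eq_xxxx)
        finally show "(2 * (L * a * \<sigma>hat\<^sup>2))\<^sup>2 = (\<sigma>hat * sqrt (8 * L * \<Delta> / real T))\<^sup>2"
          using \<Delta> T \<open>L > 0\<close> by (simp add: power_mult_distrib)
      qed (use a \<Delta> T \<open>L > 0\<close> \<open>\<sigma>hat > 0\<close> in auto)
      then have eq: "2 * \<Delta> / (a * real T) + \<delta>hat\<^sup>2 + L * a * \<sigma>hat\<^sup>2 =
          \<sigma>hat * sqrt (8 * L * \<Delta> / real T) + \<delta>hat\<^sup>2"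
        unfolding half by simp
      show ?thesis using rate[OF a aL \<alpha>] unfolding eq .
    qed
  qed
qed

end
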